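(* Let $R=S^G$ be the cyclic quotient surface singularity given by $G=\frac1n(1,a)$, and let $r$ be the number of irreducible exceptional curves in the minimal resolution of $\operatorname{Spec}R$ (equivalently, the number of non-free indecomposable special Cohen-Macaulay $R$-modules), where the dual graph of the minimal resolution is a chain whose consecutive vertices have self-intersection numbers $-\alpha_1,-\alpha_2,\dots,-\alpha_r$. Let $\mathsf N_{\mathrm e(R)}$ be the number of isomorphism classes of indecomposable Ulrich $R$-modules. Then $$r\le \mathsf N_{\mathrm e(R)}\le 2^{r-1}.$$ In particular, $\mathsf N_{\mathrm e(R)}=r$ for $r=1,2$. Furthermore, if $r>2$, then: - $\mathsf N_{\mathrm e(R)}=2^{r-1}$ holds if and only if $\alpha_u>2$ for all $u=2,\dots,r-1$; - $\mathsf N_{\mathrm e(R)}=r$ holds if and only if $\alpha_2=\cdots=\alpha_{r-1}=2$.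
   Context: $\Bbbk$ is an algebraically closed field; $n,a$ are integers with $1\le a\le n-1$, $\gcd(a,n)=1$, and $n$ is invertible in $\Bbbk$. $\frac1n(1,a)$ denotes the cyclic group generated by $\sigma=\mathrm{diag}(\zeta_n,\zeta_n^a)$, $\zeta_n$ a primitive $n$-th root of unity, acting on $S=\Bbbk[[x,y]]$ by $x\mapsto\zeta_n x$, $y\mapsto\zeta_n^a y$. $R=S^G$ is a local ring with maximal ideal $\mathfrak m$. For an integer $t$, $M_t\subset S$ is the $R$-submodule generated by the monomials $x^iy^j$ with $i+ja\equiv t \pmod n$; $M_0=R$, and $M_0,\dots,M_{n-1}$ are, up to isomorphism, exactly the indecomposable maximal Cohen-Macaulay (MCM) $R$-modules, pairwise non-isomorphic and of rank one. Ulrich module: an MCM $R$-module $M$ is Ulrich if $\mu_R(M)=\mathrm{e}_{\mathfrak m}(M)$, where $\mu_R(M)=\dim_\Bbbk M/\mathfrak mM$ and $\mathrm{e}_{\mathfrak m}(M)$ is the multiplicity of $M$ with respect to $\mathfrak m$; $\mathrm e(R)=\mathrm e_{\mathfrak m}(R)$. Since each $M_t$ has rank one, $\mathsf N_{\mathrm e(R)}=\#\{t\in\{0,\dots,n-1\}\mid \mu_R(M_t)=\mathrm e(R)\}$. An MCM module $M$ is special if $(M\otimes_R\omega_R)/\mathrm{tor}$ is also MCM ($\omega_R$ the canonical module, tor the torsion submodule). Write the Hirzebruch-Jung continued fraction $n/a=[\alpha_1,\dots,\alpha_r]=\alpha_1-\cfrac{1}{\alpha_2-\cfrac{1}{\cdots-\frac{1}{\alpha_r}}}$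 with integers $\alpha_u\ge2$. It is known that the exceptional curves of the minimal resolution of $\operatorname{Spec}R$ form a chain of $r$ curves with self-intersection numbers $-\alpha_1,\dots,-\alpha_r$ in order, and that they correspond one-to-one to the non-free indecomposable special modules. *)

theory Defs
  imports
    "HOL-Computational_Algebra.Computational_Algebra"
    "HOL-Number_Theory.Cong"
begin

(* k[[x,y]] is represented as k[[x]][[y]]: the coefficient of x^i y^j in f is f $ j $ i. *)
type_synonym 'k series2 = "'k fps fps"

definition mon :: "nat \<Rightarrow> nat \<Rightarrow> 'k::field series2" where
  "mon i j = fps_const fps_X ^ i * fps_X ^ j"

definition scalar :: "'k::field \<Rightarrow> 'k series2" where
  "scalar c = fps_const (fps_const c)"


subsection \<open>Submodules of a ring over a subring\<close>

text \<open>Throughout this part, \<open>R\<close> is (the carrier of) a subring of an ambient commutative ring, and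
  modules are \<open>R\<close>-submodules of the ambient ring.\<close>

definition rspan :: "'s::comm_ring_1 set \<Rightarrow> 's set \<Rightarrow> 's set" where
  "rspan R X = {(\<Sum>x\<in>F. c x * x) | F c. finite F \<and> F \<subseteq> X \<and> c ` F \<subseteq> R}"

definition rsubmodule :: "'s::comm_ring_1 set \<Rightarrow> 's set \<Rightarrow> bool" where
  "rsubmodule R M \<longleftrightarrow> 0 \<in> M \<and> (\<forall>f\<in>M. \<forall>g\<in>M. f + g \<in> M) \<and> (\<forall>r\<in>R. \<forall>f\<in>M. r * f \<in> M)"

definition fin_gen :: "'s::comm_ring_1 set \<Rightarrow> 's set \<Rightarrow> bool" where
  "fin_gen R M \<longleftrightarrow> (\<exists>F. finite F \<and> M = rspan R F)"

definition ideal_mult :: "'s::comm_ring_1 set \<Rightarrow> 's set \<Rightarrow> 's set \<Rightarrow> 's set" where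
  "ideal_mult R I M = rspan R {f * g | f g. f \<in> I \<and> g \<in> M}"

(* For local R, the maximal ideal consists of the non-units of R. *)
definition max_ideal :: "'s::comm_ring_1 set \<Rightarrow> 's set" where
  "max_ideal R = {f \<in> R. \<forall>g\<in>R. f * g \<noteq> 1}"

definition module_iso :: "'s::comm_ring_1 set \<Rightarrow> 's set \<Rightarrow> 's set \<Rightarrow> bool" where
  "module_iso R M N \<longleftrightarrow> (\<exists>\<phi>. bij_betw \<phi> M N \<and>
     (\<forall>f\<in>M. \<forall>g\<in>M. \<phi> (f + g) = \<phi> f + \<phi> g) \<and> (\<forall>r\<in>R. \<forall>f\<in>M. \<phi> (r * f) = r * \<phi> f))"

definition indecomposable :: "'s::comm_ring_1 set \<Rightarrow> 's set \<Rightarrow> bool" where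
  "indecomposable R M \<longleftrightarrow> M \<noteq> {0} \<and>
     \<not> (\<exists>A B. rsubmodule R A \<and> rsubmodule R B \<and> A \<noteq> {0} \<and> B \<noteq> {0} \<and>
          A \<inter> B = {0} \<and> {f + g | f g. f \<in> A \<and> g \<in> B} = M)"

definition regular_sequence :: "'s::comm_ring_1 set \<Rightarrow> 's set \<Rightarrow> 's list \<Rightarrow> bool" where
  "regular_sequence R M fs \<longleftrightarrow>
     ideal_mult R (rspan R (set fs)) M \<noteq> M \<and>
     (\<forall>i<length fs. \<forall>h\<in>M.
        fs ! i * h \<in> ideal_mult R (rspan R (set (take i fs))) M \<longrightarrow>
        h \<in> ideal_mult R (rspan R (set (take i fs))) M)"

(* Maximal Cohen-Macaulay over a local ring of dimension 2. The depth of a nonzero finitely generated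
   module never exceeds the dimension of the ring, so depth M = 2 means that the maximal ideal
   contains an M-regular sequence of length 2. *)
definition mcm :: "'s::comm_ring_1 set \<Rightarrow> 's set \<Rightarrow> bool" where
  "mcm R M \<longleftrightarrow> rsubmodule R M \<and> fin_gen R M \<and>
     (\<exists>fs. length fs = 2 \<and> set fs \<subseteq> max_ideal R \<and> regular_sequence R M fs)"


subsection \<open>Number of generators, multiplicity and Ulrich modules\<close>

(* The classes of the elements of B form a k-basis of M/N. *)
definition basis_mod :: "'k::field series2 set \<Rightarrow> 'k series2 set \<Rightarrow> 'k series2 set \<Rightarrow> bool" where
  "basis_mod B M N \<longleftrightarrow> finite B \<and> B \<subseteq> M \<and>
     (\<forall>f\<in>M. \<exists>!c. (\<forall>b. b \<notin> B \<longrightarrow> c b = 0) \<and> f - (\<Sum>b\<in>B. scalar (c b) * b) \<in> N)"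

(* dim_k (M/N); only meaningful when the quotient is finite dimensional. *)
definition quot_dim :: "'k::field series2 set \<Rightarrow> 'k series2 set \<Rightarrow> nat" where
  "quot_dim M N = (THE d. \<exists>B. basis_mod B M N \<and> card B = d)"

definition num_gens :: "'k::field series2 set \<Rightarrow> 'k series2 set \<Rightarrow> nat" where
  "num_gens R M = quot_dim M (ideal_mult R (max_ideal R) M)"

(* Hilbert-Samuel multiplicity lim 2! * length(M / m^l M) / l^2 over a two-dimensional local ring R.
   As the residue field of R is k, length is dimension over k. *)
definition multiplicity_of :: "'k::field series2 set \<Rightarrow> 'k series2 set \<Rightarrow> real" where
  "multiplicity_of R M =
     lim (\<lambda>l. fact 2 * real (quot_dim M ((ideal_mult R (max_ideal R) ^^ l) M)) / real l ^ 2)"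

definition ulrich :: "'k::field series2 set \<Rightarrow> 'k series2 set \<Rightarrow> bool" where
  "ulrich R M \<longleftrightarrow> mcm R M \<and> real (num_gens R M) = multiplicity_of R M"


subsection \<open>The cyclic quotient singularity\<close>

definition primitive_root_of_unity :: "nat \<Rightarrow> 'k::field \<Rightarrow> bool" where
  "primitive_root_of_unity n z \<longleftrightarrow> z ^ n = 1 \<and> (\<forall>m. 0 < m \<and> m < n \<longrightarrow> z ^ m \<noteq> 1)"

(* The substitution x := z x, y := z^a y. *)
definition act :: "'k::field \<Rightarrow> nat \<Rightarrow> 'k series2 \<Rightarrow> 'k series2" where
  "act z a f = Abs_fps (\<lambda>j. Abs_fps (\<lambda>i. z ^ i * (z ^ a) ^ j * (f $ j $ i)))"

definition invariant_ring :: "'k::field \<Rightarrow> nat \<Rightarrow> 'k series2 set" where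
  "invariant_ring z a = {f. \<forall>l. (act z a ^^ l) f = f}"

definition M_mod :: "nat \<Rightarrow> nat \<Rightarrow> 'k::field \<Rightarrow> int \<Rightarrow> 'k series2 set" where
  "M_mod n a z t =
     rspan (invariant_ring z a) {mon i j | i j. [int i + int j * int a = t] (mod int n)}"

(* Up to isomorphism, the indecomposable MCM modules over the invariant ring are M_0, ..., M_(n-1);
   isomorphism classes of indecomposable Ulrich modules are therefore taken within this family. *)
definition indec_ulrich :: "nat \<Rightarrow> nat \<Rightarrow> 'k::field \<Rightarrow> 'k series2 set set" where
  "indec_ulrich n a z =
     {M \<in> M_mod n a z ` {0..<int n}.
        indecomposable (invariant_ring z a) M \<and> ulrich (invariant_ring z a) M}"

definition num_ulrich :: "nat \<Rightarrow> nat \<Rightarrow> 'k::field \<Rightarrow> nat" where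
  "num_ulrich n a z =
     card (indec_ulrich n a z //
       {(M, N). M \<in> indec_ulrich n a z \<and> N \<in> indec_ulrich n a z \<and>
                module_iso (invariant_ring z a) M N})"


subsection \<open>Hirzebruch-Jung continued fractions\<close>

fun hj_fraction :: "int list \<Rightarrow> rat" where
  "hj_fraction [] = 0"
| "hj_fraction [c] = of_int c"
| "hj_fraction (c # d # cs) = of_int c - 1 / hj_fraction (d # cs)"

(* The value at [] is a dummy, excluded here. For coprime 0 < a < n there is exactly one such list; its
   entries are the negated self-intersection numbers along the chain of exceptional curves of the
   minimal resolution, so its length is the number of exceptional curves. *)
definition hj_expansion :: "nat \<Rightarrow> nat \<Rightarrow> int list \<Rightarrow> bool" where
  "hj_expansion n a \<alpha> \<longleftrightarrow> \<alpha> \<noteq> [] \<and> (\<forall>c\<in>set \<alpha>. c \<ge> 2) \<and> hj_fraction \<alpha> = of_nat n / of_nat a"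

end

theory Submission
  imports Defs "HOL-Library.Product_Plus" "HOL-Library.Product_Order"
begin

text \<open>
  The module \<open>M\<^sub>t\<close> consists of the power series whose exponents lie in the residue class
  \<open>i + a j \<equiv> t\<close> modulo \<open>n\<close>, so every invariant that matters is a count of lattice points of
  the first quadrant.

  The minimal generators of \<open>M\<^sub>t\<close> are the componentwise minimal points of its class, because the
  difference of two comparable points of one class is an invariant exponent. Those points are the
  successive record minima of \<open>t - a j\<close> modulo \<open>n\<close>, and the induced rotation on \<open>[0, a)\<close> has the
  tail of the continued fraction of \<open>n/a\<close> as its data. Hence \<open>\<mu>(M\<^sub>t) = 1 + d\<^sub>1 + \<dots> + d\<^sub>r\<close>, where
  the \<open>d\<^sub>u\<close> are the greedy digits of \<open>t\<close> with respect to the successive numerators of the fraction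
  (\<open>card_min_points\<close>).

  The Newton polygon of the nonzero invariant exponents is a chain of \<open>e = 2 + \<Sum>(\<alpha>\<^sub>u - 2)\<close> edges; the
  two endpoints of an edge form a basis of the lattice of invariant exponents (\<open>newton_polygon_chain\<close>).
  In the cone over an edge every residue class has exactly one point for each pair of integral parts of
  the coordinates, and the sum of the two coordinates agrees up to a bounded error with the order with
  respect to the maximal ideal \<open>m\<close>. So the length of \<open>M\<^sub>t/m\<^sup>l M\<^sub>t\<close> is \<open>e l\<^sup>2/2\<close> up to a linear error,
  and all \<open>M\<^sub>t\<close> have multiplicity \<open>e\<close> (\<open>layer_count_limit\<close>).

  Consequently \<open>M\<^sub>t\<close> is Ulrich iff the deviations \<open>d\<^sub>u - (\<alpha>\<^sub>u - 2)\<close> sum to \<open>1\<close>. A deviation is at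
  most \<open>1\<close>, and between two deviations equal to \<open>1\<close> there is a negative one; so for an Ulrich \<open>M\<^sub>t\<close>
  the nonzero deviations are \<open>1, -1, 1, \<dots>, 1\<close>, with \<open>-1\<close> possible exactly at the interior indices
  with \<open>\<alpha>\<^sub>u \<ge> 3\<close>. If there are no such indices, only the \<open>r\<close> patterns with a single \<open>1\<close> remain; if
  all interior indices are of this kind, every set of indices of odd size occurs, which gives
  \<open>2\<^bsup>r-1\<^esup>\<close>. The proof counts the patterns by a recursion along the continued fraction
  (\<open>residues_Cons\<close>, \<open>count_eq_power_iff\<close>, \<open>top_count_eq_length_iff\<close>).
\<close>

section \<open>Hirzebruch-Jung continued fractions\<close>

text \<open>These are the continuants: \<open>hj_num cs / hj_den cs\<close> is the value of the continued fraction in lowest terms.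
The values \<open>1\<close> and \<open>0\<close> at the empty list represent an infinite fraction; with them the recursion also
holds at the last entry, so all inductions below start at \<open>[]\<close>.\<close>

fun hj_num :: "int list \<Rightarrow> int" and hj_den :: "int list \<Rightarrow> int" where
  "hj_num [] = 1"
| "hj_num (c # cs) = c * hj_num cs - hj_den cs"
| "hj_den [] = 0"
| "hj_den (c # cs) = hj_num cs"

lemma hj_den_less_num:
  assumes "\<forall>c\<in>set cs. c \<ge> 2"
  shows "0 \<le> hj_den cs \<and> hj_den cs < hj_num cs"
  using assms
proof (induction cs)
  case (Cons c cs)
  then have IH: "0 \<le> hj_den cs" "hj_den cs < hj_num cs" by auto
  moreover have "2 * hj_num cs \<le> c * hj_num cs"
    using Cons.prems IH by (intro mult_right_mono) auto
  ultimately show ?case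
    by (simp only: hj_num.simps hj_den.simps, intro conjI) linarith+
qed auto

lemma hj_num_pos: "\<forall>c\<in>set cs. c \<ge> 2 \<Longrightarrow> hj_num cs > 0"
  using hj_den_less_num[of cs] by auto

lemma coprime_hj_num_den: "coprime (hj_num cs) (hj_den cs)"
proof (induction cs)
  case (Cons c cs)
  have "gcd (c * hj_num cs - hj_den cs) (hj_num cs) = gcd (hj_num cs) (hj_den cs)"
    by (metis diff_conv_add_uminus gcd.commute gcd_add_mult gcd_neg2 mult.commute add.commute)
  then show ?case using Cons by (simp add: coprime_iff_gcd_eq_1)
qed auto

lemma hj_fraction_eq_quotient:
  assumes "\<forall>c\<in>set cs. c \<ge> 2" "cs \<noteq> []"
  shows "hj_fraction cs = of_int (hj_num cs) / of_int (hj_den cs)"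
  using assms
proof (induction cs rule: hj_fraction.induct)
  case (3 c d cs)
  then have "hj_fraction (d # cs) = of_int (hj_num (d # cs)) / of_int (hj_den (d # cs))" by auto
  moreover have "hj_num (d # cs) > 0" using "3.prems" by (intro hj_num_pos) auto
  moreover have "hj_num cs > 0" using "3.prems" by (intro hj_num_pos) auto
  moreover have "hj_num (c # d # cs) = c * hj_num (d # cs) - hj_num cs" by simp
  moreover have "hj_den (d # cs) = hj_num cs" "hj_den (c # d # cs) = hj_num (d # cs)" by simp_all
  ultimately show ?case
    by (simp only: hj_fraction.simps) (simp add: field_simps del: hj_num.simps hj_den.simps)
qed auto

text \<open>Both \<open>n / a\<close> and the quotient of the continuants are fractions in lowest terms with positive denominator.\<close>

lemma hj_expansion_num_den:
  assumes "hj_expansion n a \<alpha>" "coprime a n" "1 \<le> a" 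
  shows "int n = hj_num \<alpha>" "int a = hj_den \<alpha>"
proof -
  have ge2: "\<forall>c\<in>set \<alpha>. c \<ge> 2" and ne: "\<alpha> \<noteq> []"
    and fr: "hj_fraction \<alpha> = of_nat n / of_nat a"
    using assms(1) unfolding hj_expansion_def by auto
  have den: "hj_den \<alpha> > 0"
    using ne ge2 hj_num_pos[of "tl \<alpha>"] by (cases \<alpha>) auto
  have num: "hj_num \<alpha> > 0" using ge2 by (rule hj_num_pos)
  have "(of_int (hj_num \<alpha>) :: rat) / of_int (hj_den \<alpha>) = of_nat n / of_nat a"
    using fr hj_fraction_eq_quotient[OF ge2 ne] by simp
  then have "(of_int (hj_num \<alpha> * int a) :: rat) = of_int (int n * hj_den \<alpha>)"
    using den assms(3) by (simp add: field_simps)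
  then have eq: "hj_num \<alpha> * int a = int n * hj_den \<alpha>" by (simp only: of_int_eq_iff)
  have "coprime (int n) (int a)" using assms(2) by (simp add: coprime_commute)
  then have "\<bar>int n\<bar> = \<bar>hj_num \<alpha>\<bar> \<and> \<bar>int a\<bar> = \<bar>hj_den \<alpha>\<bar>"
    using eq[symmetric] coprime_hj_num_den[of \<alpha>] coprime_crossproduct_int[where a = "int n" and b = "hj_num \<alpha>" and c = "hj_den \<alpha>" and d = "int a"]
      num den
    by (simp add: mult.commute coprime_commute)
  then show "int n = hj_num \<alpha>" "int a = hj_den \<alpha>" using num den by auto
qed


section \<open>Greedy digits with maximal sum\<close>

text \<open>The successive numerators of the fraction are the radices: \<open>t\<close> is divided by the largest one, and the
remainder is expanded with respect to the others. For \<open>t < hj_num cs\<close> this is the digit sum of Wunram's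
expansion.\<close>

fun greedy_sum :: "int list \<Rightarrow> int \<Rightarrow> int" where
  "greedy_sum [] t = 0"
| "greedy_sum (c # cs) t = t div hj_num cs + greedy_sum cs (t mod hj_num cs)"

text \<open>The sum of the deviations of the greedy digits from \<open>c - 2\<close>. It turns out to be \<open>1\<close> exactly for the
residues of the Ulrich modules.\<close>

definition excess :: "int list \<Rightarrow> int \<Rightarrow> int" where
  "excess cs t = greedy_sum cs t - (\<Sum>c\<leftarrow>cs. c - 2)"

lemma excess_Cons_digit:
  assumes "0 \<le> t'" "t' < hj_num cs"
  shows "excess (c # cs) (d * hj_num cs + t') = d - (c - 2) + excess cs t'"
  using assms by (simp add: excess_def div_pos_pos_trivial)

text \<open>Used with \<open>q = c\<close> for residues below \<open>n = hj_num (c # cs)\<close>, and with \<open>q = c - 1\<close> for residues below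
\<open>n - hj_den (c # cs)\<close>. In both cases a maximal first digit leaves a remainder below
\<open>hj_num cs - hj_den cs\<close>, so the bound for the remainder is of the second kind. This is why two digits
with deviation \<open>1\<close> need a negative deviation between them.\<close>

lemma first_digit_cases:
  assumes ge2: "\<forall>c\<in>set cs. c \<ge> 2" and t: "0 \<le> t" "t < q * hj_num cs - hj_den cs"
  obtains d t' where "t = d * hj_num cs + t'" "0 \<le> t'" "t' < hj_num cs" "0 \<le> d" "d < q"
    "d = q - 1 \<Longrightarrow> t' < hj_num cs - hj_den cs"
proof -
  let ?x = "hj_num cs"
  define d t' where "d = t div ?x" and "t' = t mod ?x"
  have x: "?x > 0" "0 \<le> hj_den cs" using hj_num_pos[OF ge2] hj_den_less_num[OF ge2] by auto
  have eq: "t = d * ?x + t'" by (simp add: d_def t'_def)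
  have t': "0 \<le> t'" "t' < ?x" using x by (auto simp: t'_def)
  have "d * ?x < q * ?x" using eq t' t x by linarith
  then have "d < q" using x by simp
  moreover have "t' < ?x - hj_den cs" if "d = q - 1"
    using eq t(2) that by (simp add: algebra_simps)
  moreover have "0 \<le> d" using t x by (simp add: d_def pos_imp_zdiv_nonneg_iff)
  ultimately show ?thesis using that eq t' by blast
qed

text \<open>The two bounds have to be proved together: a first digit with deviation \<open>1\<close> uses the bound \<open>0\<close> for the
remainder, a smaller one uses the bound \<open>1\<close>.\<close>

lemma excess_le:
  assumes "\<forall>c\<in>set cs. c \<ge> 2" "0 \<le> t"
  shows "(t < hj_num cs \<longrightarrow> excess cs t \<le> 1) \<and> (t < hj_num cs - hj_den cs \<longrightarrow> excess cs t \<le> 0)"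
  using assms
proof (induction cs arbitrary: t)
  case Nil then show ?case by (simp add: excess_def)
next
  case (Cons c cs)
  have ge2: "\<forall>c\<in>set cs. c \<ge> 2" using Cons.prems by auto
  have "excess (c # cs) t \<le> 1" if t: "t < hj_num (c # cs)"
  proof -
    obtain d t' where *: "t = d * hj_num cs + t'" "0 \<le> t'" "t' < hj_num cs" "0 \<le> d" "d < c"
      "d = c - 1 \<Longrightarrow> t' < hj_num cs - hj_den cs"
      using first_digit_cases[OF ge2 Cons.prems(2), of c] t by auto
    show ?thesis
      using Cons.IH[OF ge2 *(2)] *(3-6) excess_Cons_digit[OF *(2,3), of c d] *(1)
      by (cases "d = c - 1") auto
  qed
  moreover have "excess (c # cs) t \<le> 0" if t: "t < hj_num (c # cs) - hj_den (c # cs)"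
  proof -
    obtain d t' where *: "t = d * hj_num cs + t'" "0 \<le> t'" "t' < hj_num cs" "0 \<le> d" "d < c - 1"
      "d = c - 1 - 1 \<Longrightarrow> t' < hj_num cs - hj_den cs"
      using first_digit_cases[OF ge2 Cons.prems(2), of "c - 1"] t by (auto simp: algebra_simps)
    show ?thesis
      using Cons.IH[OF ge2 *(2)] *(3-6) excess_Cons_digit[OF *(2,3), of c d] *(1)
      by (cases "d = c - 2") auto
  qed
  ultimately show ?case by blast
qed

text \<open>In terms of the nonzero deviations, the top residues are given by the patterns \<open>1, -1, 1, \<dots>, 1\<close>.\<close>

definition top_residues :: "int list \<Rightarrow> int set" where
  "top_residues cs = {t. 0 \<le> t \<and> t < hj_num cs \<and> excess cs t = 1}"

text \<open>These are given by the empty pattern and the patterns \<open>-1, 1, -1, \<dots>, 1\<close>, that is, by what can follow a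
leading deviation \<open>1\<close> in a top residue.\<close>

definition level_residues :: "int list \<Rightarrow> int set" where
  "level_residues cs = {t. 0 \<le> t \<and> t < hj_num cs - hj_den cs \<and> excess cs t = 0}"

text \<open>The first deviation of a top residue is \<open>1\<close> or \<open>0\<close>, that of a level residue is \<open>0\<close> or \<open>-1\<close>, because a
smaller one cannot be compensated by the remainder. The digit for the deviation \<open>-1\<close> is \<open>c - 3\<close>, which
exists only for \<open>c \<ge> 3\<close>.\<close>

lemma residues_Cons:
  assumes "\<forall>c\<in>set (c # cs). c \<ge> 2"
  shows "top_residues (c # cs) = (\<lambda>t. (c - 1) * hj_num cs + t) ` level_residues cs
      \<union> (\<lambda>t. (c - 2) * hj_num cs + t) ` top_residues cs" (is ?A)
    and "level_residues (c # cs) = (\<lambda>t. (c - 2) * hj_num cs + t) ` level_residues cs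
      \<union> (if c \<ge> 3 then (\<lambda>t. (c - 3) * hj_num cs + t) ` top_residues cs else {})" (is ?B)
proof -
  let ?x = "hj_num cs" and ?y = "hj_den cs"
  have ge2: "\<forall>c\<in>set cs. c \<ge> 2" and c: "c \<ge> 2" using assms by auto
  have x: "0 \<le> ?y" "?y < ?x" using hj_den_less_num[OF ge2] by auto
  have cx: "0 \<le> (c - 2) * ?x" using c x by simp
  show ?A
  proof (intro equalityI subsetI)
    fix t assume "t \<in> top_residues (c # cs)"
    then have t: "0 \<le> t" "t < c * ?x - ?y" and ex: "excess (c # cs) t = 1"
      by (auto simp: top_residues_def)
    obtain d t' where *: "t = d * ?x + t'" "0 \<le> t'" "t' < ?x" "0 \<le> d" "d < c"
      "d = c - 1 \<Longrightarrow> t' < ?x - ?y"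
      using first_digit_cases[OF ge2 t] by auto
    have e: "1 = d - (c - 2) + excess cs t'" using excess_Cons_digit[OF *(2,3), of c d] ex *(1) by simp
    show "t \<in> (\<lambda>t. (c - 1) * ?x + t) ` level_residues cs \<union> (\<lambda>t. (c - 2) * ?x + t) ` top_residues cs"
    proof (cases "d = c - 1")
      case True
      then have "t' \<in> level_residues cs" using e * by (auto simp: level_residues_def)
      then show ?thesis using * True by auto
    next
      case False
      then have "d = c - 2" using e excess_le[OF ge2 *(2)] * by auto
      then have "t' \<in> top_residues cs" using e * by (auto simp: top_residues_def)
      then show ?thesis using * \<open>d = c - 2\<close> by auto
    qed
  next
    fix t assume "t \<in> (\<lambda>t. (c - 1) * ?x + t) ` level_residues cs \<union> (\<lambda>t. (c - 2) * ?x + t) ` top_residues cs"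
    then show "t \<in> top_residues (c # cs)"
    proof
      assume "t \<in> (\<lambda>t. (c - 1) * ?x + t) ` level_residues cs"
      then obtain t' where t': "t = (c - 1) * ?x + t'" "t' \<in> level_residues cs" by auto
      then have "0 \<le> t'" "t' < ?x - ?y" "excess cs t' = 0" by (auto simp: level_residues_def)
      moreover have "0 \<le> (c - 1) * ?x + t'"
        using \<open>0 \<le> t'\<close> c x by (intro add_nonneg_nonneg mult_nonneg_nonneg) auto
      ultimately show ?thesis unfolding t'(1) using x excess_Cons_digit[of t' cs c "c - 1"]
        by (auto simp: top_residues_def algebra_simps)
    next
      assume "t \<in> (\<lambda>t. (c - 2) * ?x + t) ` top_residues cs"
      then obtain t' where t': "t = (c - 2) * ?x + t'" "t' \<in> top_residues cs" by auto
      then have "0 \<le> t'" "t' < ?x" "excess cs t' = 1" by (auto simp: top_residues_def)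
      moreover have "0 \<le> (c - 2) * ?x + t'" using \<open>0 \<le> t'\<close> cx by linarith
      ultimately show ?thesis unfolding t'(1) using x excess_Cons_digit[of t' cs c "c - 2"]
        by (auto simp: top_residues_def algebra_simps)
    qed
  qed
  show ?B
  proof (intro equalityI subsetI)
    fix t assume "t \<in> level_residues (c # cs)"
    then have t: "0 \<le> t" "t < (c - 1) * ?x - ?y" and ex: "excess (c # cs) t = 0"
      by (auto simp: level_residues_def algebra_simps)
    obtain d t' where *: "t = d * ?x + t'" "0 \<le> t'" "t' < ?x" "0 \<le> d" "d < c - 1"
      "d = c - 1 - 1 \<Longrightarrow> t' < ?x - ?y"
      using first_digit_cases[OF ge2 t] by auto
    have e: "0 = d - (c - 2) + excess cs t'" using excess_Cons_digit[OF *(2,3), of c d] ex *(1) by simp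
    show "t \<in> (\<lambda>t. (c - 2) * ?x + t) ` level_residues cs
      \<union> (if c \<ge> 3 then (\<lambda>t. (c - 3) * ?x + t) ` top_residues cs else {})"
    proof (cases "d = c - 2")
      case True
      then have "t' \<in> level_residues cs" using e * by (auto simp: level_residues_def)
      then show ?thesis using * True by auto
    next
      case False
      then have "d = c - 3" using e excess_le[OF ge2 *(2)] * by auto
      then have "t' \<in> top_residues cs" using e * by (auto simp: top_residues_def)
      then show ?thesis using * \<open>d = c - 3\<close> by auto
    qed
  next
    fix t assume "t \<in> (\<lambda>t. (c - 2) * ?x + t) ` level_residues cs
      \<union> (if c \<ge> 3 then (\<lambda>t. (c - 3) * ?x + t) ` top_residues cs else {})"
    then consider "t \<in> (\<lambda>t. (c - 2) * ?x + t) ` level_residues cs"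
      | "c \<ge> 3" "t \<in> (\<lambda>t. (c - 3) * ?x + t) ` top_residues cs" by (auto split: if_splits)
    then show "t \<in> level_residues (c # cs)"
    proof cases
      case 1
      then obtain t' where t': "t = (c - 2) * ?x + t'" "t' \<in> level_residues cs" by auto
      then have "0 \<le> t'" "t' < ?x - ?y" "excess cs t' = 0" by (auto simp: level_residues_def)
      moreover have "0 \<le> (c - 2) * ?x + t'" using \<open>0 \<le> t'\<close> cx by linarith
      ultimately show ?thesis unfolding t'(1) using x excess_Cons_digit[of t' cs c "c - 2"]
        by (auto simp: level_residues_def algebra_simps)
    next
      case 2
      then obtain t' where t': "t = (c - 3) * ?x + t'" "t' \<in> top_residues cs" by auto
      have "0 \<le> (c - 3) * ?x" using 2 x by simp
      moreover have "0 \<le> t'" "t' < ?x" "excess cs t' = 1" using t' by (auto simp: top_residues_def)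
      moreover from calculation have "0 \<le> (c - 3) * ?x + t'" by linarith
      ultimately show ?thesis unfolding t'(1) using x excess_Cons_digit[of t' cs c "c - 3"]
        by (auto simp: level_residues_def algebra_simps)
    qed
  qed
qed

fun top_count :: "int list \<Rightarrow> nat" and level_count :: "int list \<Rightarrow> nat" where
  "top_count [] = 0"
| "top_count (c # cs) = level_count cs + top_count cs"
| "level_count [] = 1"
| "level_count (c # cs) = level_count cs + (if c \<ge> 3 then top_count cs else 0)"

lemma finite_residues: "finite (top_residues cs)" "finite (level_residues cs)"
proof -
  have "top_residues cs \<subseteq> {0..<hj_num cs}" "level_residues cs \<subseteq> {0..<hj_num cs - hj_den cs}"
    by (auto simp: top_residues_def level_residues_def)
  then show "finite (top_residues cs)" "finite (level_residues cs)"
    by (meson finite_atLeastLessThan_int finite_subset)+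
qed

lemma card_residues:
  assumes "\<forall>c\<in>set cs. c \<ge> 2"
  shows "card (top_residues cs) = top_count cs \<and> card (level_residues cs) = level_count cs"
  using assms
proof (induction cs)
  case Nil
  have "top_residues [] = {}" "level_residues [] = {0}"
    by (auto simp: top_residues_def level_residues_def excess_def)
  then show ?case by simp
next
  case (Cons c cs)
  then have IH: "card (top_residues cs) = top_count cs" "card (level_residues cs) = level_count cs"
    and x: "0 \<le> hj_den cs" "hj_den cs < hj_num cs"
    using hj_den_less_num[of cs] by auto
  have inj: "inj_on (\<lambda>t. k + t) A" for k :: int and A by (auto simp: inj_on_def)
  have d: "(\<lambda>t. k * hj_num cs + t) ` level_residues cs \<inter> (\<lambda>t. (k - 1) * hj_num cs + t) ` top_residues cs = {}"
    for k using x by (auto simp: level_residues_def top_residues_def algebra_simps)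
  show ?case
    using d[of "c - 1"] d[of "c - 2"] IH
    by (simp add: residues_Cons[OF Cons.prems] card_Un_disjoint finite_residues card_image inj)
qed

lemma top_count_ge_length: "length cs \<le> top_count cs \<and> 1 \<le> level_count cs"
  by (induction cs) auto

lemma count_le_power:
  "cs \<noteq> [] \<Longrightarrow> top_count cs \<le> 2 ^ (length cs - 1) \<and> level_count cs \<le> 2 ^ (length cs - 1)"
proof (induction cs)
  case (Cons c cs)
  then show ?case by (cases cs) auto
qed auto

text \<open>Doubling at every step requires both summands to be maximal. The last entry of the list imposes no
condition, since no \<open>1\<close> can follow a \<open>-1\<close> there.\<close>

lemma count_eq_power_iff:
  "(top_count (c # cs) = 2 ^ length cs \<longleftrightarrow> (\<forall>x\<in>set (butlast cs). x \<ge> 3)) \<and>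
   (level_count (c # cs) = 2 ^ length cs \<longleftrightarrow> (cs = [] \<or> c \<ge> 3) \<and> (\<forall>x\<in>set (butlast cs). x \<ge> 3))"
proof (induction cs arbitrary: c)
  case (Cons d cs)
  let ?L = "level_count (d # cs)" and ?T = "top_count (d # cs)" and ?p = "2 ^ length cs :: nat"
  have b: "?T \<le> ?p" "?L \<le> ?p" using count_le_power[of "d # cs"] by auto
  have p: "2 ^ length (d # cs) = 2 * ?p" "?p > 0" by simp_all
  have "top_count (c # d # cs) = ?L + ?T" by (rule top_count.simps)
  then have top: "top_count (c # d # cs) = 2 ^ length (d # cs) \<longleftrightarrow> ?L = ?p \<and> ?T = ?p"
    using b p by linarith
  have "level_count (c # d # cs) = ?L + (if c \<ge> 3 then ?T else 0)" by (rule level_count.simps)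
  then have level: "level_count (c # d # cs) = 2 ^ length (d # cs) \<longleftrightarrow> c \<ge> 3 \<and> ?L = ?p \<and> ?T = ?p"
    using b p by (cases "c \<ge> 3") auto
  show ?case unfolding top level using Cons.IH[of d] by (cases cs) auto
qed auto

text \<open>The level count starts at \<open>1\<close> and grows at an entry \<open>c \<ge> 3\<close> unless that entry is the last one.\<close>

lemma level_count_eq_1_iff: "level_count cs = 1 \<longleftrightarrow> (\<forall>x\<in>set (butlast cs). x < 3)"
proof (induction cs)
  case (Cons c cs)
  then show ?case using top_count_ge_length[of cs] by (cases cs) (auto simp del: top_count.simps(2))
qed auto

lemma top_count_eq_length_iff: "top_count (c # cs) = length (c # cs) \<longleftrightarrow> (\<forall>x\<in>set (butlast cs). x < 3)"
proof (induction cs arbitrary: c)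
  case (Cons d cs)
  have "top_count (c # d # cs) = length (c # d # cs) \<longleftrightarrow>
      level_count (d # cs) = 1 \<and> top_count (d # cs) = length (d # cs)"
    using top_count_ge_length[of "d # cs"] by (subst top_count.simps(2)) (simp del: top_count.simps level_count.simps, linarith)
  then show ?case using Cons.IH[of d] level_count_eq_1_iff[of "d # cs"] by auto
qed auto

lemma set_butlast_tl_iff:
  assumes "xs \<noteq> []"
  shows "(\<forall>x\<in>set (butlast (tl xs)). P x) \<longleftrightarrow> (\<forall>u\<in>{2..length xs - 1}. P (xs ! (u - 1)))"
proof -
  have "set (butlast (tl xs)) = (\<lambda>u. xs ! (u - 1)) ` {2..length xs - 1}" (is "?L = ?R")
  proof (intro equalityI subsetI)
    fix x assume "x \<in> ?L"
    then obtain k where k: "k < length (butlast (tl xs))" "x = butlast (tl xs) ! k"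
      by (metis in_set_conv_nth)
    then have "k < length xs - 2" "x = xs ! (k + 1)"
      using assms by (auto simp: nth_butlast nth_tl)
    then show "x \<in> ?R" by (intro image_eqI[of _ _ "k + 2"]) auto
  next
    fix x assume "x \<in> ?R"
    then obtain u where u: "x = xs ! (u - 1)" "2 \<le> u" "u \<le> length xs - 1" by auto
    then have "butlast (tl xs) ! (u - 2) = xs ! Suc (u - 2)" "u - 2 < length (butlast (tl xs))"
      by (auto simp: nth_butlast nth_tl)
    moreover have "Suc (u - 2) = u - 1" using u by simp
    ultimately show "x \<in> ?L" using u by (metis nth_mem)
  qed
  then show ?thesis by auto
qed

section \<open>Minimal points of a residue class\<close>

text \<open>Two points of one residue class with \<open>(i', j') \<le> (i, j)\<close> differ by an invariant exponent. So these points
are the exponents of the minimal monomial generators of the module belonging to the class of \<open>t\<close>.\<close>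

definition min_points :: "int \<Rightarrow> int \<Rightarrow> int \<Rightarrow> (int \<times> int) set" where
  "min_points n a t = {(i, j). 0 \<le> i \<and> 0 \<le> j \<and> n dvd i + a * j - t \<and>
     (\<forall>i' j'. 0 \<le> i' \<and> i' \<le> i \<and> 0 \<le> j' \<and> j' \<le> j \<and> n dvd i' + a * j' - t \<longrightarrow> i' = i \<and> j' = j)}"

lemma min_points_bound:
  assumes "n > 0" "(i, j) \<in> min_points n a t"
  shows "i < n" "j < n"
proof -
  have m: "0 \<le> i" "0 \<le> j" "n dvd i + a * j - t"
    and min: "\<And>i' j'. 0 \<le> i' \<Longrightarrow> i' \<le> i \<Longrightarrow> 0 \<le> j' \<Longrightarrow> j' \<le> j \<Longrightarrow> n dvd i' + a * j' - t \<Longrightarrow> i' = i \<and> j' = j"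
    using assms(2) unfolding min_points_def by auto
  have "n dvd (i + a * j - t) - n" "n dvd (i + a * j - t) - n * a" 
    using m(3) dvd_diff dvd_triv_left dvd_refl by blast+
  then have "n dvd (i - n) + a * j - t" "n dvd i + a * (j - n) - t"
    by (simp_all add: algebra_simps)
  then show "i < n" "j < n"
    using min[of "i - n" j] min[of i "j - n"] m assms(1) by force+
qed

lemma finite_min_points:
  assumes "n > 0"
  shows "finite (min_points n a t)"
proof (rule finite_subset)
  show "min_points n a t \<subseteq> {0..<n} \<times> {0..<n}"
  proof
    fix p assume p: "p \<in> min_points n a t"
    obtain i j where ij: "p = (i, j)" by (cases p)
    have "0 \<le> i" "0 \<le> j" using p unfolding ij min_points_def by auto
    then show "p \<in> {0..<n} \<times> {0..<n}" using min_points_bound[OF assms p[unfolded ij]] ij by simp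
  qed
qed simp

text \<open>One step of the Euclidean algorithm. The minimal points with \<open>i \<ge> a\<close> are \<open>(t - a j, j)\<close> with
\<open>j < t div a\<close>. For the points with \<open>i < a\<close> write \<open>i + a j = t + n k\<close>. The coordinates \<open>(i, k)\<close> range over
the class of \<open>t mod a\<close> modulo \<open>a\<close> with weight \<open>c a - n\<close> in place of \<open>a\<close>, and passing from \<open>(i, j)\<close> to
\<open>(i, k)\<close> preserves the componentwise order in both directions.\<close>

lemma card_min_points_step:
  fixes n a c t :: int
  assumes a: "0 < a" "a < n" and t: "0 \<le> t" "t < n" and c: "0 \<le> c * a - n" "c * a - n < a"
  shows "int (card (min_points n a t)) = t div a + int (card (min_points a (c * a - n) (t mod a)))"
proof -
  define a' d t' where "a' = c * a - n" and "d = t div a" and "t' = t mod a"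
  have t_eq: "t = d * a + t'" and t': "0 \<le> t'" "t' < a" and d: "0 \<le> d"
    using a t by (auto simp: d_def t'_def pos_imp_zdiv_nonneg_iff)
  let ?hi = "(\<lambda>j. (t - a * j, j)) ` {0..<d}" 
  let ?lo = "{p \<in> min_points n a t. fst p < a}"
  \<comment> \<open>The least nonnegative number of a residue class modulo \<open>n\<close> is its only one below \<open>n\<close>.\<close>
  have I: "n dvd x - y \<Longrightarrow> 0 \<le> x \<Longrightarrow> 0 \<le> y \<Longrightarrow> y < n \<Longrightarrow> y \<le> x" for x y :: int
  proof -
    assume "n dvd x - y" "0 \<le> x" "0 \<le> y" "y < n"
    then obtain k where k: "x - y = n * k" by (auto simp: dvd_def)
    then have "n * (-1) < n * k" using \<open>0 \<le> x\<close> \<open>y < n\<close> by linarith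
    then have "-1 < k" using a by (subst (asm) mult_less_cancel_left_pos) auto
    then have "0 \<le> n * k" using a by simp
    then show "y \<le> x" using k by simp
  qed
  have hi: "{p \<in> min_points n a t. \<not> fst p < a} = ?hi"
  proof (intro equalityI subsetI)
    fix p assume "p \<in> {p \<in> min_points n a t. \<not> fst p < a}"
    then obtain i j where p: "p = (i, j)" and mp: "(i, j) \<in> min_points n a t" and ia: "a \<le> i" by (cases p) auto
    have m: "0 \<le> i" "0 \<le> j" "n dvd i + a * j - t"
      and min: "\<And>i' j'. 0 \<le> i' \<Longrightarrow> i' \<le> i \<Longrightarrow> 0 \<le> j' \<Longrightarrow> j' \<le> j \<Longrightarrow> n dvd i' + a * j' - t \<Longrightarrow> i' = i \<and> j' = j"
      using mp unfolding min_points_def by auto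
    have jd: "j < d"
    proof (rule ccontr)
      assume "\<not> j < d"
      then have "t' = i" using min[of t' d] t_eq t' ia d by (simp add: algebra_simps)
      then show False using ia t' by simp
    qed
    have "a * (j + 1) \<le> a * d" using jd a by (intro mult_left_mono) auto
    then have ge: "t - a * j \<ge> a" using t_eq t' by (simp add: algebra_simps)
    have "a * j \<ge> 0" using a m by simp
    have dvd: "n dvd i - (t - a * j)" using m(3) by (simp add: algebra_simps)
    have "t - a * j \<le> i" using I[OF dvd] m ge t a \<open>a * j \<ge> 0\<close> by linarith
    then have "t - a * j = i" using min[of "t - a * j" j] m ge a by auto
    then show "p \<in> ?hi" using p jd m by auto
  next
    fix p assume "p \<in> ?hi"
    then obtain j where p: "p = (t - a * j, j)" and j: "0 \<le> j" "j < d" by auto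
    have "a * (j + 1) \<le> a * d" using j a by (intro mult_left_mono) auto
    then have ge: "t - a * j \<ge> a" using t_eq t' by (simp add: algebra_simps)
    have "i' = t - a * j \<and> j' = j"
      if h: "0 \<le> i'" "i' \<le> t - a * j" "0 \<le> j'" "j' \<le> j" "n dvd i' + a * j' - t" for i' j'
    proof -
      have aj: "a * j' \<le> a * j" "0 \<le> a * j'" using a h by (auto intro: mult_left_mono)
      have dvd: "n dvd i' - (t - a * j')" using h(5) by (simp add: algebra_simps)
      have "t - a * j' \<le> i'" using I[OF dvd] h aj ge a t by linarith
      then have "a * j \<le> a * j'" using h by linarith
      then have "j' = j" using a h by simp
      then show ?thesis using \<open>t - a * j' \<le> i'\<close> h by simp
    qed
    then show "p \<in> {p \<in> min_points n a t. \<not> fst p < a}"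
      using p j ge a by (auto simp: min_points_def)
  qed
  \<comment> \<open>The change of coordinates from \<open>(i, j)\<close> to \<open>(i, k)\<close> on the strip \<open>i < a\<close>, with its two domains.\<close>
  define \<phi> where "\<phi> = (\<lambda>(i, j). (i, (i + a * j - t) div n))"
  define S where "S = {(i, j). 0 \<le> i \<and> i < a \<and> 0 \<le> j \<and> n dvd i + a * j - t}"
  define S' where "S' = {(i, k). 0 \<le> i \<and> i < a \<and> 0 \<le> k \<and> a dvd i + a' * k - t'}"
  have n: "n > 0" using a by simp
  have a'k: "i + a' * k - t' = (i - t - n * k) + a * (c * k + d)" for i k
    using t_eq by (simp add: a'_def algebra_simps)
  have fwd: "(i, (i + a * j - t) div n) \<in> S'" "n * ((i + a * j - t) div n) = i + a * j - t" if "(i, j) \<in> S" for i j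
  proof -
    have s: "0 \<le> i" "i < a" "0 \<le> j" "n dvd i + a * j - t" using that by (auto simp: S_def)
    then obtain k where k: "i + a * j - t = n * k" by (auto simp: dvd_def)
    have "0 \<le> a * j" using a s by simp
    then have "n * (-1) < n * k" using k s t by linarith
    then have "-1 < k" using n by (subst (asm) mult_less_cancel_left_pos) auto
    moreover have "i + a' * k - t' = a * (c * k + d - j)"
      using k unfolding a'k by (simp add: algebra_simps)
    ultimately show "(i, (i + a * j - t) div n) \<in> S'" "n * ((i + a * j - t) div n) = i + a * j - t"
      using k n s by (auto simp: S'_def)
  qed
  have bwd: "\<exists>j. (i, j) \<in> S \<and> i + a * j - t = n * k" if "(i, k) \<in> S'" for i k
  proof -
    have s: "0 \<le> i" "i < a" "0 \<le> k" "a dvd i + a' * k - t'" using that by (auto simp: S'_def)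
    then obtain q where q: "i + a' * k - t' = a * q" by (auto simp: dvd_def)
    define j where "j = c * k + d - q"
    have j: "i + a * j - t = n * k" using q unfolding a'k j_def by (simp add: algebra_simps)
    have "0 \<le> n * k" using n s by simp
    then have "a * (-1) < a * j" using j s t by linarith
    then have "-1 < j" using a by (subst (asm) mult_less_cancel_left_pos) auto
    then show ?thesis using j s by (intro exI[of _ j]) (auto simp: S_def)
  qed
  have ord: "j1 \<le> j2 \<longleftrightarrow> k1 \<le> k2"
    if "i1 + a * j1 - t = n * k1" "i2 + a * j2 - t = n * k2" "0 \<le> i1" "i1 \<le> i2" "i2 < a" 
      for i1 j1 k1 i2 j2 k2
  proof
    assume "j1 \<le> j2"
    then have "a * j1 \<le> a * j2" using a by simp
    then have "n * k1 \<le> n * k2" using that by linarith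
    then show "k1 \<le> k2" using n by simp
  next
    assume "k1 \<le> k2"
    then have "n * k1 \<le> n * k2" using n by simp
    then have "a * (j1 - 1) < a * j2" using that by (simp add: algebra_simps)
    then show "j1 \<le> j2" using a by (subst (asm) mult_less_cancel_left_pos) auto
  qed
  have lo_S: "p \<in> ?lo \<longleftrightarrow> p \<in> S \<and> (\<forall>q\<in>S. fst q \<le> fst p \<and> snd q \<le> snd p \<longrightarrow> q = p)" for p
  proof (cases p)
    case (Pair i j)
    have "(i, j) \<in> ?lo \<longleftrightarrow> (i, j) \<in> S \<and> (\<forall>i' j'. (i', j') \<in> S \<and> i' \<le> i \<and> j' \<le> j \<longrightarrow> i' = i \<and> j' = j)"
      (is "?P \<longleftrightarrow> ?Q")
    proof
      assume ?P
      then show ?Q unfolding S_def min_points_def by auto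
    next
      assume Q: ?Q
      then have S: "(i, j) \<in> S"
        and min: "\<And>i' j'. (i', j') \<in> S \<Longrightarrow> i' \<le> i \<Longrightarrow> j' \<le> j \<Longrightarrow> i' = i \<and> j' = j" by blast+
      have "i' = i \<and> j' = j"
        if "0 \<le> i'" "i' \<le> i" "0 \<le> j'" "j' \<le> j" "n dvd i' + a * j' - t" for i' j'
        using min[of i' j'] S that unfolding S_def by simp
      then show ?P using S unfolding S_def min_points_def by (simp, blast)
    qed
    then show ?thesis unfolding Pair by auto
  qed
  have min_S': "p \<in> min_points a a' t' \<longleftrightarrow> p \<in> S' \<and> (\<forall>q\<in>S'. fst q \<le> fst p \<and> snd q \<le> snd p \<longrightarrow> q = p)" for p
  proof (cases p)
    case (Pair i k)
    have "(i, k) \<in> min_points a a' t' \<longleftrightarrow>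
        (i, k) \<in> S' \<and> (\<forall>i' k'. (i', k') \<in> S' \<and> i' \<le> i \<and> k' \<le> k \<longrightarrow> i' = i \<and> k' = k)"
      (is "?P \<longleftrightarrow> ?Q")
    proof
      assume P: ?P
      have "i < a" using min_points_bound(1)[OF a(1) P] .
      then show ?Q using P unfolding S'_def min_points_def by auto
    next
      assume ?Q
      then have S': "(i, k) \<in> S'"
        and min: "\<And>i' k'. (i', k') \<in> S' \<Longrightarrow> i' \<le> i \<Longrightarrow> k' \<le> k \<Longrightarrow> i' = i \<and> k' = k" by blast+
      have "i' = i \<and> k' = k"
        if "0 \<le> i'" "i' \<le> i" "0 \<le> k'" "k' \<le> k" "a dvd i' + a' * k' - t'" for i' k'
        using min[of i' k'] S' that unfolding S'_def by simp
      then show ?P using S' unfolding S'_def min_points_def by (simp, blast)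
    qed
    then show ?thesis unfolding Pair by auto
  qed
  have "bij_betw \<phi> ?lo (min_points a a' t')"
  proof (rule bij_betw_imageI)
    show "inj_on \<phi> ?lo"
    proof (rule inj_onI)
      fix p q assume pq: "p \<in> ?lo" "q \<in> ?lo" "\<phi> p = \<phi> q"
      obtain i j where p: "p = (i, j)" by (cases p)
      obtain i' j' where q: "q = (i', j')" by (cases q)
      have "i = i'" "(i + a * j - t) div n = (i' + a * j' - t) div n"
        using pq by (auto simp: p q \<phi>_def)
      moreover have "(i, j) \<in> S" "(i', j') \<in> S" using pq lo_S p q by blast+
      ultimately have "i + a * j - t = i + a * j' - t" using fwd(2)[of i j] fwd(2)[of i' j'] by metis
      then have "j = j'" using a by simp
      then show "p = q" using \<open>i = i'\<close> p q by simp
    qed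
    show "\<phi> ` ?lo = min_points a a' t'"
    proof (intro equalityI subsetI)
      fix p' assume "p' \<in> \<phi> ` ?lo"
      then obtain i j where ij: "(i, j) \<in> ?lo" and p': "p' = (i, (i + a * j - t) div n)"
        by (auto simp: \<phi>_def)
      have S: "(i, j) \<in> S" and min: "\<And>q. q \<in> S \<Longrightarrow> fst q \<le> i \<Longrightarrow> snd q \<le> j \<Longrightarrow> q = (i, j)"
        using ij lo_S[of "(i, j)"] by auto
      have "q = p'" if q: "q \<in> S'" "fst q \<le> fst p'" "snd q \<le> snd p'" for q
      proof -
        obtain i1 k1 where q1: "q = (i1, k1)" by (cases q)
        then obtain j1 where j1: "(i1, j1) \<in> S" "i1 + a * j1 - t = n * k1" using bwd q by blast
        have "0 \<le> i1" "i1 \<le> i" "i < a" "k1 \<le> (i + a * j - t) div n"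
          using j1(1) S q(2,3) unfolding q1 p' S_def by auto
        then have "j1 \<le> j" using ord[OF j1(2) fwd(2)[OF S, symmetric]] by blast
        then have "i1 = i" "j1 = j" using min[OF j1(1)] \<open>i1 \<le> i\<close> by auto
        then show ?thesis unfolding q1 p' using j1(2) n by simp
      qed
      then show "p' \<in> min_points a a' t'" using min_S'[of p'] fwd(1)[OF S] p' by blast
    next
      fix p' assume p': "p' \<in> min_points a a' t'"
      obtain i k where ik: "p' = (i, k)" by (cases p')
      have S': "(i, k) \<in> S'" and min: "\<And>q. q \<in> S' \<Longrightarrow> fst q \<le> i \<Longrightarrow> snd q \<le> k \<Longrightarrow> q = (i, k)"
        using p' min_S'[of p'] ik by auto
      obtain j where j: "(i, j) \<in> S" "i + a * j - t = n * k" using bwd[OF S'] by blast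
      have "q = (i, j)" if q: "q \<in> S" "fst q \<le> i" "snd q \<le> j" for q
      proof -
        obtain i1 j1 where q1: "q = (i1, j1)" by (cases q)
        define k1 where "k1 = (i1 + a * j1 - t) div n"
        have k1: "(i1, k1) \<in> S'" "i1 + a * j1 - t = n * k1" using fwd[of i1 j1] q q1 by (auto simp: k1_def)
        have "0 \<le> i1" "i1 \<le> i" "i < a" "j1 \<le> j"
          using j(1) q unfolding q1 S_def by auto
        then have "k1 \<le> k" using ord[OF k1(2) j(2)] by blast
        then have "i1 = i" "k1 = k" using min[OF k1(1)] \<open>i1 \<le> i\<close> by auto
        then have "a * j1 = a * j" using k1(2) j(2) by (metis add_left_cancel diff_add_cancel)
        then show ?thesis using q1 \<open>i1 = i\<close> a by simp
      qed
      then have "(i, j) \<in> S \<and> (\<forall>q\<in>S. fst q \<le> fst (i, j) \<and> snd q \<le> snd (i, j) \<longrightarrow> q = (i, j))"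
        using j(1) unfolding fst_conv snd_conv by blast
      then have "(i, j) \<in> ?lo" by (rule lo_S[THEN iffD2])
      moreover have "\<phi> (i, j) = p'" using j n ik by (simp add: \<phi>_def)
      ultimately show "p' \<in> \<phi> ` ?lo" by blast
    qed
  qed
  then have lo_card: "card ?lo = card (min_points a a' t')" by (rule bij_betw_same_card)
  have "inj_on (\<lambda>j. (t - a * j, j)) {0..<d}" by (auto simp: inj_on_def)
  then have "int (card {p \<in> min_points n a t. \<not> fst p < a}) = d" using d unfolding hi by (simp add: card_image)
  moreover have "card (min_points n a t) = card ?lo + card {p \<in> min_points n a t. \<not> fst p < a}"
    using finite_min_points[OF n] by (subst card_Un_disjoint[symmetric]) (auto intro: arg_cong[of _ _ card])
  ultimately show ?thesis using lo_card by (simp add: a'_def d_def t'_def)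
qed


lemma card_min_points:
  assumes "\<forall>c\<in>set cs. c \<ge> 2" "0 \<le> t" "t < hj_num cs"
  shows "int (card (min_points (hj_num cs) (hj_den cs) t)) = greedy_sum cs t + 1"
  using assms
proof (induction cs arbitrary: t)
  case Nil
  have "min_points 1 0 0 = {(0, 0)}" by (auto simp: min_points_def)
  moreover have "t = 0" using Nil by simp
  ultimately show ?case by simp
next
  case (Cons c cs)
  let ?x = "hj_num cs" and ?y = "hj_den cs"
  have ge2: "\<forall>c\<in>set cs. c \<ge> 2" using Cons.prems by auto
  have x: "0 \<le> ?y" "?y < ?x" using hj_den_less_num[OF ge2] by auto
  have n: "?x < hj_num (c # cs)" using hj_den_less_num[OF Cons.prems(1)] by simp
  have "c * ?x - hj_num (c # cs) = ?y" by simp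
  then have "int (card (min_points (hj_num (c # cs)) ?x t))
      = t div ?x + int (card (min_points ?x ?y (t mod ?x)))"
    using card_min_points_step[of ?x "hj_num (c # cs)" t c] x n Cons.prems by simp
  moreover have "int (card (min_points ?x ?y (t mod ?x))) = greedy_sum cs (t mod ?x) + 1"
    using Cons.IH[OF ge2, of "t mod ?x"] x by simp
  ultimately show ?case by simp
qed

section \<open>Sums of invariant exponents\<close>

definition sumset :: "'a::plus set \<Rightarrow> 'a set \<Rightarrow> 'a set" where
  "sumset A B = {x + y | x y. x \<in> A \<and> y \<in> B}"

definition coset_points :: "int \<Rightarrow> int \<Rightarrow> int \<Rightarrow> (int \<times> int) set" where
  "coset_points n a t = {(i, j). 0 \<le> i \<and> 0 \<le> j \<and> n dvd i + a * j - t}"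

text \<open>The exponents of the product of the \<open>l\<close>-th power of the maximal ideal with the module of the class of
\<open>t\<close>: sums of a point of the class and \<open>l\<close> nonzero invariant exponents.\<close>

definition layer :: "int \<Rightarrow> int \<Rightarrow> int \<Rightarrow> nat \<Rightarrow> (int \<times> int) set" where
  "layer n a t l = (sumset (coset_points n a 0 - {0}) ^^ l) (coset_points n a t)"

lemma coset_points_add:
  assumes "p \<in> coset_points n a s" "q \<in> coset_points n a t"
  shows "p + q \<in> coset_points n a (s + t)"
proof -
  obtain i j i' j' where pq: "p = (i, j)" "q = (i', j')" by fastforce
  have "n dvd i + a * j - s" "n dvd i' + a * j' - t" using assms by (auto simp: pq coset_points_def)
  then have "n dvd (i + a * j - s) + (i' + a * j' - t)" by (rule dvd_add)
  then show ?thesis using assms unfolding pq coset_points_def by (simp add: algebra_simps)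
qed

lemma coset_points_diff:
  assumes "p \<in> coset_points n a s" "q \<in> coset_points n a t" "fst q \<le> fst p" "snd q \<le> snd p"
  shows "p - q \<in> coset_points n a (s - t)"
proof -
  obtain i j i' j' where pq: "p = (i, j)" "q = (i', j')" by fastforce
  have "n dvd i + a * j - s" "n dvd i' + a * j' - t" using assms by (auto simp: pq coset_points_def)
  then have "n dvd (i + a * j - s) - (i' + a * j' - t)" by (rule dvd_diff)
  then show ?thesis using assms(3,4) unfolding pq coset_points_def by (simp add: algebra_simps)
qed

lemma sumset_mono: "B \<subseteq> C \<Longrightarrow> sumset A B \<subseteq> sumset A C"
  by (auto simp: sumset_def)

lemma layer_0: "layer n a t 0 = coset_points n a t"
  and layer_Suc: "layer n a t (Suc l) = sumset (coset_points n a 0 - {0}) (layer n a t l)"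
  by (simp_all add: layer_def)

lemma layer_decreasing: "layer n a t (l + k) \<subseteq> layer n a t l"
proof -
  have "layer n a t (Suc l) \<subseteq> layer n a t l" for l
  proof (induction l)
    case 0
    then show ?case using coset_points_add[of _ n a 0 _ t] by (auto simp: layer_0 layer_Suc sumset_def)
  next
    case (Suc l) then show ?case using layer_Suc sumset_mono by metis
  qed
  then show ?thesis by (induction k) auto
qed

lemma coset_minus_sumset_eq_min_points:
  "coset_points n a t - sumset (coset_points n a 0 - {0}) (coset_points n a t) = min_points n a t"
proof (intro equalityI subsetI)
  fix p assume p: "p \<in> coset_points n a t - sumset (coset_points n a 0 - {0}) (coset_points n a t)"
  obtain i j where ij: "p = (i, j)" by (cases p)
  have "i' = i \<and> j' = j" if "0 \<le> i'" "i' \<le> i" "0 \<le> j'" "j' \<le> j" "n dvd i' + a * j' - t" for i' j'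
  proof (rule ccontr)
    assume ne: "\<not> (i' = i \<and> j' = j)"
    have q: "(i', j') \<in> coset_points n a t" using that by (simp add: coset_points_def)
    then have "p - (i', j') \<in> coset_points n a 0 - {0}"
      using coset_points_diff[of p n a t "(i', j')" t] p that ne by (auto simp: ij zero_prod_def)
    moreover have "p = (p - (i', j')) + (i', j')" by simp
    ultimately show False using p q unfolding sumset_def by blast
  qed
  then show "p \<in> min_points n a t" using p unfolding ij min_points_def coset_points_def by auto
next
  fix p assume p: "p \<in> min_points n a t"
  then have c: "p \<in> coset_points n a t" by (auto simp: min_points_def coset_points_def)
  moreover have "p \<notin> sumset (coset_points n a 0 - {0}) (coset_points n a t)"
  proof
    assume "p \<in> sumset (coset_points n a 0 - {0}) (coset_points n a t)"
    then obtain h q where hq: "p = h + q" "h \<in> coset_points n a 0" "h \<noteq> 0" "q \<in> coset_points n a t"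
      unfolding sumset_def by blast
    obtain i j i' j' where ij: "h = (i, j)" "q = (i', j')" by fastforce
    have "0 \<le> i" "0 \<le> j" "0 \<le> i'" "0 \<le> j'" "n dvd i' + a * j' - t"
      using hq(2,4) by (auto simp: ij coset_points_def)
    moreover have "(i + i', j + j') \<in> min_points n a t" using p hq(1) by (simp add: ij)
    ultimately have "i' = i + i' \<and> j' = j + j'"
      unfolding min_points_def mem_Collect_eq case_prod_conv by (metis add.commute le_add_same_cancel1)
    then have "q = p" by (simp add: hq(1) ij)
    then show False using hq by simp
  qed
  ultimately show "p \<in> coset_points n a t - sumset (coset_points n a 0 - {0}) (coset_points n a t)" by blast
qed


section \<open>The Newton polygon\<close>

definition cross :: "int \<times> int \<Rightarrow> int \<times> int \<Rightarrow> int" where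
  "cross u v = fst u * snd v - snd u * fst v"

text \<open>The chains of such pairs that lead from \<open>(n, 0)\<close> to \<open>(0, n)\<close> serve as the Newton polygon of the invariant
exponents. The determinant condition makes the cone over each edge unimodular for the lattice of invariant
exponents; the signs of the increments make the linear form that is constant on an edge positive on the
first quadrant.\<close>

definition edges :: "int \<Rightarrow> int \<Rightarrow> ((int \<times> int) \<times> (int \<times> int)) set" where
  "edges n a = {(u, v). cross u v = n \<and> fst v < fst u \<and> snd u < snd v \<and> 
     v \<in> coset_points n a 0}"

text \<open>Adding a multiple of the direction \<open>(-y, b)\<close> to the first point does not change the determinant of two
consecutive points.\<close>

lemma edge_chain_segment:
  assumes "n > 0" "y > 0" "b > 0" "x * b - y * b' = n" "n dvd x - a * b'" "n dvd y - a * b"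
    "0 \<le> x - (1 + int k) * y" "0 \<le> b - b'"
  shows "((x - y, b - b'), (x - (1 + int k) * y, (1 + int k) * b - b')) \<in> edges n a ^^ k"
  using assms
proof (induction k)
  case (Suc k)
  have le: "0 \<le> x - (1 + int k) * y" using Suc.prems by (auto simp: algebra_simps)
  have "0 \<le> b * int k" using Suc.prems by simp
  then have "b' \<le> b * int k + b * 2" using Suc.prems by linarith
  have "n dvd (x - a * b') - (2 + int k) * (y - a * b)"
    by (rule dvd_diff[OF Suc.prems(5) dvd_mult[OF Suc.prems(6)]])
  then have "((x - (1 + int k) * y, (1 + int k) * b - b'),
      (x - (1 + int (Suc k)) * y, (1 + int (Suc k)) * b - b')) \<in> edges n a"
    using Suc.prems le \<open>b' \<le> b * int k + b * 2\<close> by (simp add: edges_def cross_def coset_points_def algebra_simps)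
  then show ?case using Suc.IH[OF Suc.prems(1-6) le Suc.prems(8)] by (auto simp: relcomp_unfold)
qed auto

text \<open>Put \<open>s' = (-x, b')\<close> and \<open>s = (-y, b)\<close>, where \<open>x / y\<close> is the value of the fraction. The chain starts at
\<open>s - s'\<close> and uses the direction \<open>s\<close> for \<open>c - 2\<close> steps, where \<open>c\<close> is the first entry. It then stands at
\<open>s'' - s\<close> with \<open>s'' = c s - s'\<close>, which is the start of the chain for the remaining entries. The last step
ends on the second axis.\<close>

lemma edge_chain_from_fraction:
  assumes "\<forall>c\<in>set cs. c \<ge> 2" "n > 0" "0 \<le> b'" "b' < b" "cs = [] \<longrightarrow> b' > 0"
    "hj_num cs * b - hj_den cs * b' = n" "n dvd hj_num cs - a * b'" "n dvd hj_den cs - a * b"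
  shows "((hj_num cs - hj_den cs, b - b'), (0, n)) \<in> edges n a ^^ (nat (\<Sum>c\<leftarrow>cs. c - 2) + 1)"
  using assms
proof (induction cs arbitrary: b b')
  case Nil
  then show ?case by (auto simp: edges_def cross_def coset_points_def)
next
  case (Cons c cs)
  let ?x = "hj_num (c # cs)" and ?y = "hj_num cs" and ?z = "hj_den cs" and ?k = "nat (c - 2)"
  have ge2: "\<forall>c\<in>set cs. c \<ge> 2" and c: "c \<ge> 2" using Cons.prems by auto
  have yz: "0 \<le> ?z" "?z < ?y" using hj_den_less_num[OF ge2] by auto
  have eq: "?x - (1 + int ?k) * ?y = ?y - ?z" "(1 + int ?k) * b - b' = (c * b - b') - b"
    using c by (simp_all add: algebra_simps)
  have 1: "((?x - ?y, b - b'), (?y - ?z, (c * b - b') - b)) \<in> edges n a ^^ ?k"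
    using edge_chain_segment[of n ?y b ?x b' a ?k] Cons.prems yz unfolding eq by simp
  have "1 * b \<le> (c - 1) * b" using c Cons.prems by (intro mult_right_mono) auto
  then have b: "b < c * b - b'" using Cons.prems(4) unfolding left_diff_distrib by linarith
  have "n dvd ?y - a * b" using Cons.prems by simp
  then have "n dvd c * (?y - a * b) - (?x - a * b')" by (rule dvd_diff[OF dvd_mult Cons.prems(7)])
  then have d: "n dvd ?z - a * (c * b - b')" by (simp add: algebra_simps)
  have 2: "((?y - ?z, (c * b - b') - b), (0, n)) \<in> edges n a ^^ (nat (\<Sum>c\<leftarrow>cs. c - 2) + 1)"
  proof (rule Cons.IH[OF ge2 \<open>n > 0\<close> _ b _ _ _ d])
    show "?y * (c * b - b') - ?z * b = n" using Cons.prems(6) by (simp add: algebra_simps)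
  qed (use Cons.prems in auto)
  have "0 \<le> (\<Sum>c\<leftarrow>cs. c - 2)" using ge2 by (induction cs) auto
  then have k: "?k + (nat (\<Sum>c\<leftarrow>cs. c - 2) + 1) = nat (\<Sum>c\<leftarrow>c # cs. c - 2) + 1" using c by simp
  have "((?x - ?y, b - b'), (0, n)) \<in> edges n a ^^ (?k + (nat (\<Sum>c\<leftarrow>cs. c - 2) + 1))"
    using relcompI[OF 1 2] by (simp only: relpow_add)
  then show ?case by (simp only: k hj_den.simps)
qed

text \<open>Each entry \<open>c\<close> contributes \<open>c - 2\<close> edges. The two further edges are the step away from the first axis and
the step onto the second one.\<close>

lemma newton_polygon_chain:
  assumes "\<forall>c\<in>set cs. c \<ge> 2" "cs \<noteq> []"
  obtains w where "w 0 = (hj_num cs, 0)" "w (nat (\<Sum>c\<leftarrow>cs. c - 2) + 2) = (0, hj_num cs)"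
    "\<And>m. m < nat (\<Sum>c\<leftarrow>cs. c - 2) + 2 \<Longrightarrow> (w m, w (Suc m)) \<in> edges (hj_num cs) (hj_den cs)"
proof -
  let ?n = "hj_num cs" and ?a = "hj_den cs"
  have na: "0 \<le> ?a" "?a < ?n" using hj_den_less_num[OF assms(1)] by auto
  have a: "?a > 0" using assms hj_num_pos[of "tl cs"] by (cases cs) auto
  have "((?n, 0), (?n - ?a, 1)) \<in> edges ?n ?a"
    using na a by (simp add: edges_def cross_def coset_points_def)
  moreover have "((?n - ?a, 1), (0, ?n)) \<in> edges ?n ?a ^^ (nat (\<Sum>c\<leftarrow>cs. c - 2) + 1)"
    using edge_chain_from_fraction[OF assms(1), of ?n 0 1 ?a] assms(2) na by simp
  ultimately have "((?n, 0), (0, ?n)) \<in> edges ?n ?a ^^ (nat (\<Sum>c\<leftarrow>cs. c - 2) + 2)"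
    by (metis relpow_Suc_I2 add_Suc_right one_add_one plus_1_eq_Suc)
  then show ?thesis using that unfolding relpow_fun_conv by auto
qed



section \<open>Lattice points in the cones over the edges\<close>

text \<open>By Cramer's rule \<open>cross p v / n\<close> and \<open>cross u p / n\<close> are the coordinates of \<open>p\<close> with respect to the basis
\<open>u\<close>, \<open>v\<close>; the cell consists of their integral parts.\<close>

definition cell :: "int \<Rightarrow> int \<times> int \<Rightarrow> int \<times> int \<Rightarrow> int \<times> int \<Rightarrow> int \<times> int" where
  "cell n u v p = (cross p v div n, cross u p div n)"

text \<open>The invariant exponents generate a lattice of index \<open>n\<close> in the plane.\<close>

lemma cross_lattice_dvd:
  assumes "n dvd fst p + a * snd p" "n dvd fst q + a * snd q"
  shows "n dvd cross p q"
proof -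
  have "cross p q = (fst p + a * snd p) * snd q - snd p * (fst q + a * snd q)"
    by (simp add: cross_def algebra_simps)
  then show ?thesis using assms by (metis dvd_diff dvd_mult dvd_mult2)
qed

lemma cross_expansion:
  "cross u v * fst p = cross p v * fst u + cross u p * fst v"
  "cross u v * snd p = cross p v * snd u + cross u p * snd v"
  by (simp_all add: cross_def algebra_simps)

lemma cross_diff: "cross (p - q) v = cross p v - cross q v" "cross u (p - q) = cross u p - cross u q"
  by (simp_all add: cross_def left_diff_distrib right_diff_distrib)

lemma coset_pointsD:
  assumes "p \<in> coset_points n a t"
  shows "0 \<le> fst p" "0 \<le> snd p" "n dvd fst p + a * snd p - t"
  using assms unfolding coset_points_def by auto

lemma edge_facts:
  assumes "(u, v) \<in> edges n a"
  shows "cross u v = n" "fst v < fst u" "snd u < snd v" "v \<in> coset_points n a 0"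
    "0 \<le> fst v" "0 \<le> snd v" "n dvd fst v + a * snd v"
  using assms unfolding edges_def coset_points_def by auto

text \<open>The difference of two points of one class has integral coordinates with respect to \<open>u\<close> and \<open>v\<close>, so the
fractional parts of the coordinates are the same for all points of a class.\<close>

lemma inj_on_cell:
  assumes e: "(u, v) \<in> edges n a" and u: "u \<in> coset_points n a 0" and n: "n > 0"
  shows "inj_on (cell n u v) (coset_points n a t)"
proof (rule inj_onI)
  fix p q assume p: "p \<in> coset_points n a t" and q: "q \<in> coset_points n a t"
    and eq: "cell n u v p = cell n u v q"
  have "n dvd (fst p + a * snd p - t) - (fst q + a * snd q - t)"
    by (rule dvd_diff[OF coset_pointsD(3)[OF p] coset_pointsD(3)[OF q]])
  then have pq: "n dvd fst (p - q) + a * snd (p - q)" by (simp add: algebra_simps)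
  have uv: "n dvd fst u + a * snd u" "n dvd fst v + a * snd v"
    using u edge_facts[OF e] by (auto simp: coset_points_def)
  have "n dvd cross p v - cross q v" "n dvd cross u p - cross u q"
    using cross_lattice_dvd[OF pq uv(2)] cross_lattice_dvd[OF uv(1) pq]
    by (simp_all only: cross_diff)
  then have "cross p v mod n = cross q v mod n" "cross u p mod n = cross u q mod n"
    by (simp_all add: mod_eq_dvd_iff)
  moreover have "cross p v div n = cross q v div n" "cross u p div n = cross u q div n"
    using eq by (simp_all add: cell_def)
  ultimately have "cross p v = cross q v" "cross u p = cross u q"
    by (metis mult_div_mod_eq)+
  then have "n * fst p = n * fst q" "n * snd p = n * snd q"
    using cross_expansion[of u v p] cross_expansion[of u v q] edge_facts(1)[OF e] by simp_all
  then show "p = q" using n by (simp add: prod_eq_iff)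
qed

text \<open>Subtracting \<open>c\<close> times \<open>u\<close> and \<open>d\<close> times \<open>v\<close> leaves a point with nonnegative coordinates, hence a point of
the class.\<close>

lemma in_layer_of_cell:
  assumes e: "(u, v) \<in> edges n a" and u: "u \<in> coset_points n a 0" and n: "n > 0"
    and p: "p \<in> coset_points n a t" and c: "cell n u v p = (int c, int d)"
  shows "p \<in> layer n a t (c + d)"
proof -
  have uv: "u \<in> coset_points n a 0 - {0}" "v \<in> coset_points n a 0 - {0}"
    using u edge_facts[OF e] by (auto simp: coset_points_def)
  define w where "w = (\<lambda>c' d'. (fst p - int c' * fst u - int d' * fst v, snd p - int c' * snd u - int d' * snd v))"
  have w: "w c d \<in> coset_points n a t"
  proof -
    have cd: "cross p v div n = int c" "cross u p div n = int d" using c by (simp_all add: cell_def)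
    define r s where "r = cross p v mod n" and "s = cross u p mod n"
    have div: "cross p v = n * int c + r" "cross u p = n * int d + s"
      unfolding r_def s_def cd[symmetric] by simp_all
    have "n * fst (w c d) = r * fst u + s * fst v" "n * snd (w c d) = r * snd u + s * snd v"
      using cross_expansion[of u v p] unfolding edge_facts(1)[OF e] div
      by (simp_all add: w_def algebra_simps)
    moreover have "0 \<le> r" "0 \<le> s" using n by (simp_all add: r_def s_def)
    ultimately have "0 \<le> n * fst (w c d)" "0 \<le> n * snd (w c d)"
      using coset_pointsD(1,2)[OF u] edge_facts(5,6)[OF e] by simp_all
    then have nonneg: "0 \<le> fst (w c d)" "0 \<le> snd (w c d)" using n by (simp_all add: zero_le_mult_iff)
    have d1: "n dvd fst p + a * snd p - t" "n dvd int c * (fst u + a * snd u)" "n dvd int d * (fst v + a * snd v)"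
      using coset_pointsD(3)[OF p] coset_pointsD(3)[OF u] edge_facts(7)[OF e] by simp_all
    have "n dvd (fst p + a * snd p - t) - int c * (fst u + a * snd u) - int d * (fst v + a * snd v)"
      by (rule dvd_diff[OF dvd_diff[OF d1(1,2)] d1(3)])
    then have "n dvd fst (w c d) + a * snd (w c d) - t" by (simp add: w_def algebra_simps)
    then show ?thesis using nonneg by (simp add: coset_points_def split_beta)
  qed
  have add: "q \<in> layer n a t l \<Longrightarrow> h \<in> coset_points n a 0 - {0} \<Longrightarrow> h + q \<in> layer n a t (Suc l)" for q h l
    unfolding layer_Suc sumset_def by blast
  have "c' \<le> c \<Longrightarrow> w (c - c') d \<in> layer n a t c'" for c'
  proof (induction c')
    case 0 then show ?case using w by (simp add: layer_0)
  next
    case (Suc c')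
    then have "u + w (c - c') d \<in> layer n a t (Suc c')" using add uv by simp
    moreover have "u + w (c - c') d = w (c - Suc c') d"
      using Suc.prems by (cases u) (simp add: w_def algebra_simps of_nat_diff)
    ultimately show ?case by simp
  qed
  then have w0: "w 0 d \<in> layer n a t c" by (metis diff_self_eq_0 order_refl)
  have "d' \<le> d \<Longrightarrow> w 0 (d - d') \<in> layer n a t (c + d')" for d'
  proof (induction d')
    case 0 then show ?case using w0 by simp
  next
    case (Suc d')
    then have "v + w 0 (d - d') \<in> layer n a t (Suc (c + d'))" using add uv by simp
    moreover have "v + w 0 (d - d') = w 0 (d - Suc d')"
      using Suc.prems by (cases v) (simp add: w_def algebra_simps of_nat_diff)
    ultimately show ?case by simp
  qed
  then have "w 0 0 \<in> layer n a t (c + d)" by (metis diff_self_eq_0 order_refl)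
  then show ?thesis by (simp add: w_def)
qed


text \<open>The linear form that takes the value \<open>n\<close> at both ends of the edge has positive coefficients, and its
values on the invariant exponents are divisible by \<open>n\<close>. So it is at least \<open>n\<close> at each nonzero one.\<close>

lemma cross_edge_ge_of_layer:
  assumes e: "(u, v) \<in> edges n a" and u: "u \<in> coset_points n a 0" and n: "n > 0"
  shows "p \<in> layer n a t l \<Longrightarrow> n * int l \<le> cross p (v - u)"
proof (induction l arbitrary: p)
  case 0
  have "0 \<le> fst p * (snd v - snd u)" "0 \<le> snd p * (fst u - fst v)"
    using 0 edge_facts[OF e] by (auto simp: layer_0 coset_points_def)
  then show ?case by (simp add: cross_def algebra_simps)
next
  case (Suc l)
  then obtain h q where hq: "p = h + q" "h \<in> coset_points n a 0" "h \<noteq> 0" "q \<in> layer n a t l"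
    unfolding layer_Suc sumset_def by blast
  have uv: "n dvd fst u + a * snd u" "n dvd fst v + a * snd v" and hd: "n dvd fst h + a * snd h"
    and h0: "0 \<le> fst h" "0 \<le> snd h"
    using u edge_facts[OF e] hq by (auto simp: coset_points_def)
  have d: "n dvd cross h v - cross h u"
    by (rule dvd_diff[OF cross_lattice_dvd[OF hd uv(2)] cross_lattice_dvd[OF hd uv(1)]])
  have eq: "cross h v - cross h u = fst h * (snd v - snd u) + snd h * (fst u - fst v)"
    by (simp add: cross_def algebra_simps)
  have "fst h > 0 \<or> snd h > 0" using hq(3) h0 by (cases h) (auto simp: zero_prod_def)
  then have "0 < fst h * (snd v - snd u) + snd h * (fst u - fst v)"
    using h0 edge_facts(2,3)[OF e] by (auto intro: add_pos_nonneg add_nonneg_pos)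
  then have "n \<le> cross h v - cross h u" using d unfolding eq by (metis zdvd_imp_le)
  moreover have "n * int l \<le> cross q (v - u)" using Suc.IH hq by blast
  moreover have "cross p (v - u) = (cross h v - cross h u) + cross q (v - u)"
    by (simp add: hq(1) cross_def algebra_simps)
  ultimately show ?case by (simp add: algebra_simps)
qed

text \<open>Start from any integral point of the class, here \<open>(t, 0)\<close>, and translate it by integral multiples of \<open>u\<close>
and \<open>v\<close>. A point with nonnegative coordinates with respect to \<open>u\<close> and \<open>v\<close> lies in the first quadrant.\<close>

lemma ex_point_of_cell:
  assumes e: "(u, v) \<in> edges n a" and u: "u \<in> coset_points n a 0" and n: "n > 0"
    and cd: "0 \<le> c" "0 \<le> d"
  shows "\<exists>p\<in>coset_points n a t. cell n u v p = (c, d)"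
proof -
  define r s where "r = (t * snd v) mod n" and "s = (- (snd u * t)) mod n"
  define k l where "k = c - (t * snd v) div n" and "l = d - (- (snd u * t)) div n"
  define p where "p = (t + k * fst u + l * fst v, k * snd u + l * snd v)"
  have uv: "0 \<le> fst u" "0 \<le> snd u" "n dvd fst u + a * snd u" and cr: "cross u v = n"
    using u edge_facts[OF e] by (auto simp: coset_points_def)
  note v = edge_facts[OF e]
  have rs: "0 \<le> r" "r < n" "0 \<le> s" "s < n" using n by (simp_all add: r_def s_def)
  have "cross p v = t * snd v + k * cross u v" "cross u p = - (snd u * t) + l * cross u v"
    by (simp_all add: p_def cross_def algebra_simps)
  moreover have "t * snd v = n * ((t * snd v) div n) + r"
    "- (snd u * t) = n * ((- (snd u * t)) div n) + s"
    unfolding r_def s_def by (rule mult_div_mod_eq[symmetric])+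
  ultimately have eq: "cross p v = r + c * n" "cross u p = s + d * n"
    by (simp_all add: cr k_def l_def algebra_simps)
  have "n * fst p = (r + c * n) * fst u + (s + d * n) * fst v"
    "n * snd p = (r + c * n) * snd u + (s + d * n) * snd v"
    using cross_expansion[of u v p] eq cr by simp_all
  then have "0 \<le> n * fst p" "0 \<le> n * snd p" using rs n cd uv v by auto
  then have "0 \<le> fst p" "0 \<le> snd p" using n by (simp_all add: zero_le_mult_iff)
  moreover have "fst p + a * snd p - t = k * (fst u + a * snd u) + l * (fst v + a * snd v)"
    by (simp add: p_def algebra_simps)
  then have "n dvd fst p + a * snd p - t" using uv(3) v(7) by (metis dvd_add dvd_mult)
  ultimately have "p \<in> coset_points n a t" by (simp add: coset_points_def split_beta)
  moreover have "cell n u v p = (c, d)"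
    using rs unfolding cell_def eq by (simp add: div_pos_pos_trivial)
  ultimately show ?thesis by blast
qed

definition triangle :: "nat \<Rightarrow> (int \<times> int) set" where
  "triangle l = {(c, d). 0 \<le> c \<and> 0 \<le> d \<and> c + d < int l}"

lemma card_triangle: "finite (triangle l) \<and> 2 * card (triangle l) = l * (l + 1)"
proof (induction l)
  case 0
  have "triangle 0 = {}" by (auto simp: triangle_def)
  then show ?case by simp
next
  case (Suc l)
  let ?D = "(\<lambda>c. (c, int l - c)) ` {0..int l}"
  have "triangle (Suc l) = triangle l \<union> ?D" by (auto simp: triangle_def)
  moreover have "triangle l \<inter> ?D = {}" by (auto simp: triangle_def)
  moreover have "card ?D = l + 1" by (subst card_image) (auto simp: inj_on_def)
  ultimately show ?case using Suc by (simp add: card_Un_disjoint)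
qed

text \<open>For the upper bound, every point of the class lies in the cone over some edge, and a point with cell
\<open>(c, d)\<close> lies in layer \<open>c + d\<close>; so the points outside layer \<open>l\<close> have cells with \<open>c + d < l\<close>. For the lower
bound, a point with cell \<open>(c, d)\<close> and \<open>c + d + 2 \<le> l\<close> lies below the line through the edge scaled by \<open>l\<close>
and is therefore outside layer \<open>l\<close>. Only the cells with \<open>c \<ge> 1\<close> are counted there, which makes the
contributions of different cones disjoint.\<close>

lemma card_coset_minus_layer:
  assumes "\<forall>c\<in>set cs. c \<ge> 2" "cs \<noteq> []"
  defines "n \<equiv> hj_num cs" and "a \<equiv> hj_den cs" and "e \<equiv> nat (\<Sum>c\<leftarrow>cs. c - 2) + 2"
  shows "finite (coset_points n a t - layer n a t l)"
    and "2 * card (coset_points n a t - layer n a t l) \<le> e * (l * (l + 1))"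
    and "e * ((l - 2) * (l - 2 + 1)) \<le> 2 * card (coset_points n a t - layer n a t l)"
proof -
  let ?I = "coset_points n a t"
  have n: "n > 0" using hj_num_pos[OF assms(1)] by (simp add: n_def)
  obtain w where w0: "w 0 = (n, 0)" and we: "w e = (0, n)"
    and edge: "\<And>m. m < e \<Longrightarrow> (w m, w (Suc m)) \<in> edges n a"
    using newton_polygon_chain[OF assms(1,2)] unfolding n_def a_def e_def by blast
  have w_in: "w m \<in> coset_points n a 0" if "m \<le> e" for m
  proof (cases m)
    case 0 then show ?thesis using w0 n by (simp add: coset_points_def)
  next
    case (Suc k) then show ?thesis using edge_facts(4)[OF edge[of k]] that by simp
  qed
  define F where "F = (\<lambda>m. cell n (w m) (w (Suc m)))"
  have inj: "inj_on (F m) ?I" if "m < e" for m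
    unfolding F_def by (rule inj_on_cell[OF edge[OF that] w_in[OF less_imp_le[OF that]] n])
  have sub: "?I - layer n a t l \<subseteq> (\<Union>m<e. {p \<in> ?I. F m p \<in> triangle l})"
  proof
    fix p assume p: "p \<in> ?I - layer n a t l"
    then have pI: "p \<in> ?I" by simp
    note nonneg = coset_pointsD(1,2)[OF pI]
    \<comment> \<open>The first vertex after \<open>w 0\<close> on or beyond the ray through \<open>p\<close> ends the edge whose cone contains \<open>p\<close>.\<close>
    let ?P = "\<lambda>m. m > 0 \<and> cross (w m) p \<le> 0"
    have "?P e" using we n nonneg by (auto simp: cross_def e_def)
    then have L: "?P (LEAST m. ?P m)" "(LEAST m. ?P m) \<le> e" by (rule LeastI, rule Least_le)
    then obtain m where m: "(LEAST m. ?P m) = Suc m" using gr0_implies_Suc by blast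
    then have me: "m < e" and le: "cross (w (Suc m)) p \<le> 0" using L by auto
    have "\<not> ?P m" using not_less_Least[of m ?P] m by auto
    then have ge: "0 \<le> cross (w m) p" using w0 n nonneg by (cases "m = 0") (auto simp: cross_def)
    have le': "0 \<le> cross p (w (Suc m))" using le by (simp add: cross_def mult.commute)
    define c d where "c = nat (cross p (w (Suc m)) div n)" and "d = nat (cross (w m) p div n)"
    have cell: "F m p = (int c, int d)"
      using ge le' n by (simp add: F_def cell_def c_def d_def pos_imp_zdiv_nonneg_iff)
    have "p \<in> layer n a t (c + d)"
      using in_layer_of_cell[OF edge[OF me] w_in[OF less_imp_le[OF me]] n pI] cell
      by (simp add: F_def)
    then have "\<not> l \<le> c + d"
      using p layer_decreasing[of n a t l "c + d - l"] by auto
    then have "F m p \<in> triangle l" using cell by (simp add: triangle_def)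
    then show "p \<in> (\<Union>m<e. {p \<in> ?I. F m p \<in> triangle l})" using me pI by blast
  qed
  have card_le: "finite {p \<in> ?I. F m p \<in> triangle l}"
    "card {p \<in> ?I. F m p \<in> triangle l} \<le> card (triangle l)" if "m < e" for m
  proof -
    have i: "inj_on (F m) {p \<in> ?I. F m p \<in> triangle l}"
      using inj[OF that] by (rule inj_on_subset) blast
    have s: "F m ` {p \<in> ?I. F m p \<in> triangle l} \<subseteq> triangle l" by blast
    show "finite {p \<in> ?I. F m p \<in> triangle l}"
      using finite_imageD[OF finite_subset[OF s] i] card_triangle by blast
    show "card {p \<in> ?I. F m p \<in> triangle l} \<le> card (triangle l)"
      using card_inj_on_le[OF i s] card_triangle by blast
  qed
  have fin: "finite (\<Union>m<e. {p \<in> ?I. F m p \<in> triangle l})" using card_le by blast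
  show fin': "finite (?I - layer n a t l)" by (rule finite_subset[OF sub fin])
  have "card (?I - layer n a t l) \<le> card (\<Union>m<e. {p \<in> ?I. F m p \<in> triangle l})"
    by (rule card_mono[OF fin sub])
  also have "\<dots> \<le> (\<Sum>m<e. card {p \<in> ?I. F m p \<in> triangle l})" by (rule card_UN_le) simp
  also have "\<dots> \<le> (\<Sum>m<e. card (triangle l))" using card_le by (intro sum_mono) auto
  finally have "2 * card (?I - layer n a t l) \<le> e * (2 * card (triangle l))" by simp
  then show "2 * card (?I - layer n a t l) \<le> e * (l * (l + 1))" using card_triangle[of l] by simp
  define T where "T = {(c, d). 1 \<le> c \<and> 0 \<le> d \<and> c + d \<le> int l - 2}"
  have T: "(c, d) \<in> T \<longleftrightarrow> 1 \<le> c \<and> 0 \<le> d \<and> c + d \<le> int l - 2" for c d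
    by (simp add: T_def)
  have cardT: "card T = card (triangle (l - 2))"
  proof -
    have "T = (\<lambda>(c, d). (c + 1, d)) ` triangle (l - 2)"
    proof (intro equalityI subsetI)
      fix q assume q: "q \<in> T"
      obtain c d where cd: "q = (c, d)" by (cases q)
      have "(c - 1, d) \<in> triangle (l - 2)" using q T by (auto simp: cd triangle_def)
      then show "q \<in> (\<lambda>(c, d). (c + 1, d)) ` triangle (l - 2)"
        by (intro image_eqI[of _ _ "(c - 1, d)"]) (simp_all add: cd)
    qed (auto simp: T_def triangle_def)
    moreover have "inj_on (\<lambda>(c::int, d::int). (c + 1, d)) (triangle (l - 2))" by (auto simp: inj_on_def)
    ultimately show ?thesis by (simp add: card_image)
  qed
  define E where "E = (\<lambda>m. {p \<in> ?I. F m p \<in> T})"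
  have cardE: "card (E m) = card T" if me: "m < e" for m
  proof -
    have "bij_betw (F m) (E m) T"
    proof (rule bij_betw_imageI)
      show "inj_on (F m) (E m)" using inj[OF me] by (rule inj_on_subset) (auto simp: E_def)
      show "F m ` E m = T"
      proof (intro equalityI subsetI)
        fix q assume q: "q \<in> T"
        obtain c d where cd: "q = (c, d)" by (cases q)
        then obtain p where "p \<in> ?I" "F m p = (c, d)"
          using ex_point_of_cell[OF edge[OF me] w_in[OF less_imp_le[OF me]] n, of c d t] q T
          by (auto simp: F_def)
        then have "p \<in> E m" "q = F m p" using q cd by (simp_all add: E_def)
        then show "q \<in> F m ` E m" by simp
      qed (auto simp: E_def)
    qed
    then show ?thesis by (rule bij_betw_same_card)
  qed
  have E_sub: "E m \<subseteq> ?I - layer n a t l" if m: "m < e" for m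
  proof
    fix p assume p: "p \<in> E m"
    let ?c = "cross p (w (Suc m)) div n" and ?d = "cross (w m) p div n"
    have "(?c, ?d) \<in> T" "p \<in> ?I" using p by (auto simp: E_def F_def cell_def)
    then have cd: "?c + ?d \<le> int l - 2" using T by blast
    have "cross p (w (Suc m)) = n * ?c + cross p (w (Suc m)) mod n" "cross (w m) p = n * ?d + cross (w m) p mod n"
      by simp_all
    moreover have "cross p (w (Suc m)) mod n < n" "cross (w m) p mod n < n" using n by simp_all
    moreover have "cross p (w (Suc m) - w m) = cross p (w (Suc m)) + cross (w m) p"
      by (simp add: cross_def algebra_simps)
    ultimately have "cross p (w (Suc m) - w m) < n * (?c + ?d + 2)" unfolding distrib_left by linarith
    also have "\<dots> \<le> n * int l" using cd n by (intro mult_left_mono) auto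
    finally have "p \<notin> layer n a t l"
      using cross_edge_ge_of_layer[OF edge[OF m] w_in[OF less_imp_le[OF m]] n, of p t l] by linarith
    then show "p \<in> ?I - layer n a t l" using \<open>p \<in> ?I\<close> by blast
  qed
  have disj: "E m \<inter> E m' = {}" if "m < m'" "m' < e" for m m'
  proof (rule ccontr)
    assume "E m \<inter> E m' \<noteq> {}"
    then obtain p where p: "p \<in> E m" "p \<in> E m'" by blast
    then have pI: "p \<in> ?I" and "(cross p (w (Suc m)) div n, cross (w m) p div n) \<in> T"
      "(cross p (w (Suc m')) div n, cross (w m') p div n) \<in> T"
      by (auto simp: E_def F_def cell_def)
    then have "1 \<le> cross p (w (Suc m)) div n" "0 \<le> cross (w m') p div n" using T by blast+
    then have "\<not> cross p (w (Suc m)) \<le> 0" "0 \<le> cross (w m') p"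
      using n div_nonpos_pos_le0[of "cross p (w (Suc m))" n] by (auto simp: pos_imp_zdiv_nonneg_iff)
    \<comment> \<open>Once the chain has passed the ray through \<open>p\<close>, it does not come back.\<close>
    moreover have "cross p (w k) \<le> cross p (w (Suc k))" if "k < e" for k
    proof -
      have "fst p * snd (w k) \<le> fst p * snd (w (Suc k))" "snd p * fst (w (Suc k)) \<le> snd p * fst (w k)"
        using edge_facts(2,3)[OF edge[OF that]] coset_pointsD(1,2)[OF pI] by (auto intro: mult_left_mono)
      then show ?thesis by (simp add: cross_def)
    qed
    then have "k \<le> e \<Longrightarrow> Suc m \<le> k \<Longrightarrow> cross p (w (Suc m)) \<le> cross p (w k)" for k
    proof (induction k)
      case (Suc k)
      then show ?case by (cases "Suc m = Suc k") (auto intro: order_trans)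
    qed simp
    then have "cross p (w (Suc m)) \<le> cross p (w m')" using that by simp
    ultimately show False by (simp add: cross_def mult.commute)
  qed
  have "card (\<Union>m<e. E m) = (\<Sum>m<e. card (E m))"
  proof (rule card_UN_disjoint)
    show "\<forall>i\<in>{..<e}. finite (E i)" using E_sub fin' finite_subset by blast
    show "\<forall>i\<in>{..<e}. \<forall>j\<in>{..<e}. i \<noteq> j \<longrightarrow> E i \<inter> E j = {}"
      using disj by (metis Int_commute lessThan_iff linorder_neqE_nat)
  qed simp
  also have "\<dots> = e * card T" using cardE by simp
  finally have "e * (2 * card T) = 2 * card (\<Union>m<e. E m)" by simp
  also have "\<dots> \<le> 2 * card (?I - layer n a t l)"
    using E_sub by (intro mult_left_mono card_mono fin') auto
  finally show "e * ((l - 2) * (l - 2 + 1)) \<le> 2 * card (?I - layer n a t l)"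
    using card_triangle[of "l - 2"] cardT by simp
qed

lemma layer_count_limit:
  assumes "\<forall>c\<in>set cs. c \<ge> 2" "cs \<noteq> []"
  shows "(\<lambda>l. 2 * real (card (coset_points (hj_num cs) (hj_den cs) t - layer (hj_num cs) (hj_den cs) t l)) / real l ^ 2)
    \<longlonglongrightarrow> real (nat (\<Sum>c\<leftarrow>cs. c - 2) + 2)"
proof (rule real_tendsto_sandwich)
  let ?e = "real (nat (\<Sum>c\<leftarrow>cs. c - 2) + 2)"
  let ?N = "\<lambda>l. card (coset_points (hj_num cs) (hj_den cs) t - layer (hj_num cs) (hj_den cs) t l)"
  note count = card_coset_minus_layer[OF assms]
  show "\<forall>\<^sub>F l in sequentially. ?e * ((1 - 2 / real l) * (1 - 1 / real l)) \<le> 2 * real (?N l) / real l ^ 2"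
  proof (rule eventually_sequentiallyI)
    fix l :: nat assume l: "l \<ge> 2"
    have "real ((nat (\<Sum>c\<leftarrow>cs. c - 2) + 2) * ((l - 2) * (l - 2 + 1))) \<le> real (2 * ?N l)"
      using count(3)[of l t] by (simp only: of_nat_le_iff)
    moreover have "real ((l - 2) * (l - 2 + 1)) = (real l - 2) * (real l - 1)"
    proof -
      obtain k where "l = 2 + k" using l le_Suc_ex by blast
      then show ?thesis by (simp add: algebra_simps)
    qed
    ultimately have "?e * ((real l - 2) * (real l - 1)) \<le> 2 * real (?N l)"
      by (simp only: of_nat_mult[of "nat (\<Sum>c\<leftarrow>cs. c - 2) + 2"])
    then have "?e * ((real l - 2) * (real l - 1)) / real l ^ 2 \<le> 2 * real (?N l) / real l ^ 2"
      by (rule divide_right_mono) simp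
    moreover have "(1 - 2 / real l) * (1 - 1 / real l) = (real l - 2) * (real l - 1) / real l ^ 2"
      using l by (simp add: field_simps power2_eq_square)
    ultimately show "?e * ((1 - 2 / real l) * (1 - 1 / real l)) \<le> 2 * real (?N l) / real l ^ 2"
      by simp
  qed
  show "\<forall>\<^sub>F l in sequentially. 2 * real (?N l) / real l ^ 2 \<le> ?e * (1 + 1 / real l)"
  proof (rule eventually_sequentiallyI)
    fix l :: nat assume l: "l \<ge> 1"
    have "real (2 * ?N l) \<le> real ((nat (\<Sum>c\<leftarrow>cs. c - 2) + 2) * (l * (l + 1)))"
      using count(2)[of t l] by (simp only: of_nat_le_iff)
    then have "2 * real (?N l) \<le> ?e * (real l * (real l + 1))"
      unfolding of_nat_mult[of "nat (\<Sum>c\<leftarrow>cs. c - 2) + 2"] by (simp add: algebra_simps)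
    then have "2 * real (?N l) / real l ^ 2 \<le> ?e * (real l * (real l + 1)) / real l ^ 2"
      by (rule divide_right_mono) simp
    moreover have "1 + 1 / real l = (real l * (real l + 1)) / real l ^ 2"
      using l by (simp add: field_simps power2_eq_square)
    ultimately show "2 * real (?N l) / real l ^ 2 \<le> ?e * (1 + 1 / real l)" by simp
  qed
  have "(\<lambda>l. ?e * ((1 - 2 / real l) * (1 - 1 / real l))) \<longlonglongrightarrow> ?e * ((1 - 0) * (1 - 0))"
    by (intro tendsto_intros lim_const_over_n)
  then show "(\<lambda>l. ?e * ((1 - 2 / real l) * (1 - 1 / real l))) \<longlonglongrightarrow> ?e" by simp
  have "(\<lambda>l. ?e * (1 + 1 / real l)) \<longlonglongrightarrow> ?e * (1 + 0)"
    by (intro tendsto_intros lim_const_over_n)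
  then show "(\<lambda>l. ?e * (1 + 1 / real l)) \<longlonglongrightarrow> ?e" by simp
qed

section \<open>Power series with prescribed support\<close>

text \<open>The pair \<open>(i, j)\<close> stands for the monomial \<open>x\<^sup>i y\<^sup>j\<close>, whereas the outer variable of the iterated power
series is \<open>y\<close>.\<close>

definition coef :: "'k::field series2 \<Rightarrow> nat \<times> nat \<Rightarrow> 'k" where
  "coef f p = f $ snd p $ fst p"

definition series_of :: "(nat \<times> nat \<Rightarrow> 'k::field) \<Rightarrow> 'k series2" where
  "series_of u = Abs_fps (\<lambda>j. Abs_fps (\<lambda>i. u (i, j)))"

definition xmon :: "nat \<times> nat \<Rightarrow> 'k::field series2" where
  "xmon p = mon (fst p) (snd p)"

definition supported_on :: "(nat \<times> nat) set \<Rightarrow> 'k::field series2 set" where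
  "supported_on A = {f. \<forall>p. p \<notin> A \<longrightarrow> coef f p = 0}"

lemma series2_eqI: "(\<And>p. coef f p = coef g p) \<Longrightarrow> f = g"
  by (intro fps_ext) (metis coef_def fst_conv snd_conv)

lemma coef_series_of [simp]: "coef (series_of u) p = u p"
  by (simp add: coef_def series_of_def)

lemma coef_simps [simp]:
  "coef 0 p = 0" "coef (f + g) p = coef f p + coef g p" "coef (f - g) p = coef f p - coef g p"
  "coef (- f) p = - coef f p" "coef (scalar c * f) p = c * coef f p"
  by (simp_all add: coef_def scalar_def)

lemma coef_sum [simp]: "coef (\<Sum>x\<in>F. g x) p = (\<Sum>x\<in>F. coef (g x) p)"
  by (simp add: coef_def fps_sum_nth)

lemma coef_1 [simp]: "coef 1 p = (if p = 0 then 1 else 0)"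
  by (cases p) (simp add: coef_def zero_prod_def)

lemma coef_mult:
  "coef (f * g) p = (\<Sum>j=0..snd p. \<Sum>i=0..fst p. coef f (i, j) * coef g (p - (i, j)))"
  by (cases p) (simp add: coef_def fps_mult_nth fps_sum_nth)

lemma mon_eq: "mon i j = fps_const (fps_X ^ i) * fps_X ^ j"
  by (simp add: mon_def fps_const_power)

lemma coef_xmon_mult: "coef (xmon q * f) p = (if q \<le> p then coef f (p - q) else 0)"
proof -
  obtain i j i' j' where pq: "p = (i, j)" "q = (i', j')" by fastforce
  have "coef (xmon q * f) p = (fps_X ^ i' * ((fps_X ^ j' * f) $ j)) $ i"
    by (simp add: pq coef_def xmon_def mon_eq mult.assoc)
  also have "\<dots> = (if j < j' then 0 else (fps_X ^ i' * (f $ (j - j'))) $ i)"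
    by (simp add: fps_X_power_mult_nth)
  also have "\<dots> = (if q \<le> p then coef f (p - q) else 0)"
    by (simp add: pq coef_def fps_X_power_mult_nth not_less less_eq_prod_def)
  finally show ?thesis .
qed

lemma coef_xmon [simp]: "coef (xmon q) p = (if p = q then 1 else 0)"
  using coef_xmon_mult[of q 1 p] by (auto simp: less_eq_prod_def zero_prod_def prod_eq_iff minus_prod_def)

lemma xmon_mult: "xmon p * xmon q = xmon (p + q)"
  by (simp add: xmon_def mon_def power_add)

lemma xmon_0: "xmon 0 = 1"
  by (simp add: xmon_def mon_def)

lemma inj_xmon: "inj xmon"
proof (rule injI)
  fix p q assume "xmon p = (xmon q :: 'a series2)"
  then have "coef (xmon p :: 'a series2) p = coef (xmon q :: 'a series2) p" by simp
  then show "p = q" by (simp split: if_splits)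
qed

lemma supported_onD: "f \<in> supported_on A \<Longrightarrow> p \<notin> A \<Longrightarrow> coef f p = 0"
  unfolding supported_on_def by blast

lemma supported_on_closed:
  "0 \<in> supported_on A"
  "f \<in> supported_on A \<Longrightarrow> g \<in> supported_on A \<Longrightarrow> f + g \<in> supported_on A"
  "f \<in> supported_on A \<Longrightarrow> g \<in> supported_on A \<Longrightarrow> f - g \<in> supported_on A"
  "f \<in> supported_on A \<Longrightarrow> scalar c * f \<in> supported_on A"
  "(\<And>x. x \<in> F \<Longrightarrow> h x \<in> supported_on A) \<Longrightarrow> sum h F \<in> supported_on A"
  by (auto simp: supported_on_def)

lemma xmon_in_supported_on [simp]: "xmon p \<in> supported_on A \<longleftrightarrow> p \<in> A"
proof
  assume "xmon p \<in> (supported_on A :: 'a series2 set)"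
  then show "p \<in> A" using supported_onD[of "xmon p :: 'a series2" A p] by fastforce
next
  assume "p \<in> A"
  then have "coef (xmon p :: 'a series2) q = 0" if "q \<notin> A" for q using that by auto
  then show "xmon p \<in> (supported_on A :: 'a series2 set)" unfolding supported_on_def by blast
qed

lemma supported_on_subset_iff [simp]: "supported_on A \<subseteq> (supported_on B :: 'k::field series2 set) \<longleftrightarrow> A \<subseteq> B"
proof
  assume sub: "supported_on A \<subseteq> (supported_on B :: 'k series2 set)"
  show "A \<subseteq> B" using sub xmon_in_supported_on[where ?'a = 'k] by blast
qed (auto simp: supported_on_def)

lemma supported_on_eq_iff: "supported_on A = (supported_on B :: 'k::field series2 set) \<longleftrightarrow> A = B"
  unfolding set_eq_subset by simp

lemma supported_on_mult:
  assumes "f \<in> supported_on A" "g \<in> supported_on B"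
  shows "f * g \<in> supported_on (sumset A B)"
  unfolding supported_on_def
proof (intro CollectI allI impI)
  fix p assume p: "p \<notin> sumset A B"
  have "coef f (i, j) * coef g (p - (i, j)) = 0" if "i \<le> fst p" "j \<le> snd p" for i j
  proof (rule ccontr)
    assume "\<not> ?thesis"
    then have "(i, j) \<in> A" "p - (i, j) \<in> B" using assms supported_onD by fastforce+
    moreover have "p = (i, j) + (p - (i, j))" using that by (cases p) simp
    ultimately show False using p unfolding sumset_def by blast
  qed
  then show "coef (f * g) p = 0" unfolding coef_mult by (intro sum.neutral ballI) auto
qed

lemma sumset_assoc: "sumset (sumset A B) C = sumset A (sumset B (C :: (nat \<times> nat) set))"
  unfolding sumset_def by (auto simp: add.assoc) (metis add.assoc)+

lemma sumset_commute: "sumset A B = sumset B (A :: (nat \<times> nat) set)"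
proof -
  have "sumset C D \<subseteq> sumset D C" for C D :: "(nat \<times> nat) set"
  proof
    fix x assume "x \<in> sumset C D"
    then obtain c d where "x = c + d" "c \<in> C" "d \<in> D" unfolding sumset_def by blast
    moreover from this have "x = d + c" by (simp only: add.commute)
    ultimately show "x \<in> sumset D C" unfolding sumset_def by blast
  qed
  then show ?thesis by blast
qed

lemma sumset_submonoid:
  fixes H :: "(nat \<times> nat) set"
  assumes "0 \<in> H" "sumset H H \<subseteq> H"
  shows "sumset H H = H"
proof -
  have "H \<subseteq> sumset H H"
  proof
    fix h assume "h \<in> H"
    moreover have "h = 0 + h" by simp
    ultimately show "h \<in> sumset H H" using assms(1) unfolding sumset_def by blast
  qed
  then show ?thesis using assms(2) by blast
qed

lemma sumset_generated:
  fixes F G H :: "(nat \<times> nat) set"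
  assumes "sumset H H = H"
  shows "sumset (sumset F H) (sumset G H) = sumset (sumset F G) H"
  by (metis assms sumset_assoc sumset_commute)

lemma finite_sumset: "finite A \<Longrightarrow> finite B \<Longrightarrow> finite (sumset A B)"
proof -
  assume f: "finite A" "finite B"
  have "sumset A B = (\<lambda>(x, y). x + y) ` (A \<times> B)" by (auto simp: sumset_def)
  then show ?thesis using f by simp
qed

text \<open>Each exponent is assigned to one of the finitely many monomials that generate it, and the coefficients are
collected accordingly. So a series with infinite support is still a finite combination of monomials with
coefficients in the ring.\<close>

lemma rspan_supported_on:
  fixes H :: "(nat \<times> nat) set"
  assumes F: "finite F" and HH: "sumset H H \<subseteq> H"
  shows "rspan (supported_on H) (xmon ` F) = (supported_on (sumset F H) :: 'k::field series2 set)"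
proof (intro equalityI subsetI)
  fix f :: "'k series2" assume "f \<in> rspan (supported_on H) (xmon ` F)"
  then obtain F' c where f: "f = (\<Sum>x\<in>F'. c x * x)" "F' \<subseteq> xmon ` F" "c ` F' \<subseteq> supported_on H"
    unfolding rspan_def by blast
  have "c x * x \<in> supported_on (sumset F H)" if "x \<in> F'" for x
  proof -
    have "c x * x \<in> supported_on (sumset H F)"
      using f that by (intro supported_on_mult) auto
    then show ?thesis by (simp only: sumset_commute)
  qed
  then show "f \<in> supported_on (sumset F H)" unfolding f(1) by (intro supported_on_closed)
next
  fix f :: "'k series2" assume f: "f \<in> supported_on (sumset F H)"
  have "\<exists>b. b \<in> F \<and> b \<le> p \<and> p - b \<in> H" if p: "p \<in> sumset F H" for p
  proof -
    obtain b h where "p = b + h" "b \<in> F" "h \<in> H" using p by (auto simp: sumset_def)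
    then show ?thesis by (intro exI[of _ b]) (simp add: less_eq_prod_def)
  qed
  then obtain g where g: "\<And>p. p \<in> sumset F H \<Longrightarrow> g p \<in> F \<and> g p \<le> p \<and> p - g p \<in> H"
    by metis
  define c where "c = (\<lambda>b. series_of (\<lambda>h. if h \<in> H \<and> g (b + h) = b then coef f (b + h) else 0))"
  have c: "c b \<in> supported_on H" for b by (auto simp: c_def supported_on_def)
  have "f = (\<Sum>b\<in>F. c b * xmon b)"
  proof (rule series2_eqI)
    fix p
    have *: "coef (c b * xmon b) p = (if b \<le> p \<and> p - b \<in> H \<and> g p = b then coef f p else 0)" for b
    proof -
      have "coef (c b * xmon b) p = coef (xmon b * c b) p" by (simp only: mult.commute)
      moreover have "b + (p - b) = p" if "b \<le> p"
        using that by (cases b; cases p) (simp add: less_eq_prod_def)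
      ultimately show ?thesis by (simp add: coef_xmon_mult c_def)
    qed
    show "coef f p = coef (\<Sum>b\<in>F. c b * xmon b) p"
    proof (cases "p \<in> sumset F H")
      case True
      have "(\<Sum>b\<in>F. coef (c b * xmon b) p) = (\<Sum>b\<in>F. if g p = b then coef f p else 0)"
        unfolding * using g[OF True] by (intro sum.cong) auto
      then show ?thesis using F g[OF True] by simp
    next
      case False
      have "coef (c b * xmon b) p = 0" if "b \<in> F" for b
        unfolding * using supported_onD[OF f False] by simp
      then show ?thesis using supported_onD[OF f False] by simp
    qed
  qed
  also have "\<dots> = (\<Sum>x\<in>xmon ` F. c (inv xmon x) * x)"
    by (subst sum.reindex) (auto simp: inj_on_def inv_f_f[OF inj_xmon] dest: injD[OF inj_xmon])
  finally have eq: "f = (\<Sum>x\<in>xmon ` F. c (inv xmon x) * x)" .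
  show "f \<in> rspan (supported_on H) (xmon ` F)"
    unfolding rspan_def
  proof (intro CollectI exI conjI)
    show "f = (\<Sum>x\<in>xmon ` F. c (inv xmon x) * x)" by (rule eq)
    show "(\<lambda>x. c (inv xmon x)) ` xmon ` F \<subseteq> supported_on H" using c by (intro image_subsetI)
  qed (use F in auto)
qed

lemma rspan_mono: "X \<subseteq> Y \<Longrightarrow> rspan R X \<subseteq> rspan R Y"
  unfolding rspan_def by blast

lemma rspan_le_supported_on:
  assumes "X \<subseteq> supported_on A" "sumset H A \<subseteq> A"
  shows "rspan (supported_on H) X \<subseteq> (supported_on A :: 'k::field series2 set)"
proof
  fix f :: "'k series2" assume "f \<in> rspan (supported_on H) X"
  then obtain F' c where f: "f = (\<Sum>x\<in>F'. c x * x)" "F' \<subseteq> X" "c ` F' \<subseteq> supported_on H"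
    unfolding rspan_def by blast
  have "c x * x \<in> supported_on (sumset H A)" if "x \<in> F'" for x
    using f that assms by (intro supported_on_mult) auto
  moreover have "supported_on (sumset H A) \<subseteq> (supported_on A :: 'k series2 set)" using assms by simp
  ultimately show "f \<in> supported_on A" unfolding f(1) by (intro supported_on_closed) blast
qed

text \<open>The product is generated by the finitely many products of generating monomials, so it contains all series
with the right support and not only finite sums of products of monomials.\<close>

lemma ideal_mult_supported_on:
  fixes H :: "(nat \<times> nat) set"
  assumes H: "0 \<in> H" "sumset H H \<subseteq> H" and F: "finite F" "A = sumset F H" and G: "finite G" "B = sumset G H"
  shows "ideal_mult (supported_on H) (supported_on A) (supported_on B)
    = (supported_on (sumset A B) :: 'k::field series2 set)"
proof
  have HH: "sumset H H = H" by (rule sumset_submonoid[OF H])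
  have AB: "sumset A B = sumset (sumset F G) H"
    unfolding F G by (rule sumset_generated[OF HH])
  have HAB: "sumset H (sumset A B) \<subseteq> sumset A B"
    unfolding AB by (metis HH sumset_assoc sumset_commute order_refl)
  show "ideal_mult (supported_on H) (supported_on A) (supported_on B)
      \<subseteq> (supported_on (sumset A B) :: 'k series2 set)"
    unfolding ideal_mult_def by (rule rspan_le_supported_on) (use HAB supported_on_mult in auto)
  have "xmon ` sumset F G \<subseteq> {f * g :: 'k series2 | f g. f \<in> supported_on A \<and> g \<in> supported_on B}"
  proof
    fix x :: "'k series2" assume "x \<in> xmon ` sumset F G"
    then obtain p q where "x = xmon p * xmon q" "p \<in> F" "q \<in> G"
      by (auto simp: sumset_def xmon_mult)
    moreover have "p = p + 0" "q = q + 0" for p q :: "nat \<times> nat" by simp_all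
    then have "F \<subseteq> A" "G \<subseteq> B" using H unfolding F G sumset_def by blast+
    ultimately show "x \<in> {f * g :: 'k series2 | f g. f \<in> supported_on A \<and> g \<in> supported_on B}"
      using xmon_in_supported_on by blast
  qed
  then show "(supported_on (sumset A B) :: 'k series2 set) \<subseteq> ideal_mult (supported_on H) (supported_on A) (supported_on B)"
    unfolding AB ideal_mult_def
    using rspan_supported_on[OF finite_sumset[OF F(1) G(1)] H(2)] rspan_mono by blast
qed

section \<open>Dimensions of quotients\<close>

lemma supported_on_mono: "f \<in> supported_on A \<Longrightarrow> A \<subseteq> B \<Longrightarrow> f \<in> supported_on B"
  unfolding supported_on_def by blast

text \<open>Restriction to \<open>A - B\<close> is a linear map on \<open>supported_on A\<close> with kernel \<open>supported_on B\<close>. It replaces the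
quotient space by a subspace of the space of all series, to which linear algebra applies.\<close>

definition restrict_to :: "(nat \<times> nat) set \<Rightarrow> 'k::field series2 \<Rightarrow> 'k series2" where
  "restrict_to D f = series_of (\<lambda>p. if p \<in> D then coef f p else 0)"

lemma coef_restrict_to [simp]: "coef (restrict_to D f) p = (if p \<in> D then coef f p else 0)"
  by (simp add: restrict_to_def)

lemma restrict_to_sum_scaled:
  "restrict_to D (\<Sum>b\<in>C. scalar (u b) * g b) = (\<Sum>b\<in>C. scalar (u b) * restrict_to D (g b))"
  by (rule series2_eqI) (simp add: sum.neutral)

lemma scalar_simps:
  "scalar 0 = 0" "scalar 1 = 1" "scalar (c + d) = scalar c + scalar d"
  "scalar (c * d) = scalar c * scalar d" "scalar (- c) = - scalar c"
  by (simp_all add: scalar_def)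

lemma vector_space_series2: "vector_space (\<lambda>c (f :: 'k::field series2). scalar c * f)"
  by unfold_locales (simp_all add: scalar_simps algebra_simps)

lemma in_supported_on_iff_restrict_eq_0:
  assumes "f \<in> supported_on A" "B \<subseteq> A"
  shows "f \<in> supported_on B \<longleftrightarrow> restrict_to (A - B) f = 0"
proof
  assume "f \<in> supported_on B"
  then show "restrict_to (A - B) f = 0"
    by (intro series2_eqI) (simp add: supported_onD)
next
  assume r: "restrict_to (A - B) f = 0"
  have "coef f p = 0" if "p \<notin> B" for p
  proof (cases "p \<in> A")
    case True
    then have "coef (restrict_to (A - B) f) p = coef f p" using that by simp
    then show ?thesis using r by simp
  next
    case False
    then show ?thesis using assms(1) supported_onD by blast
  qed
  then show "f \<in> supported_on B" unfolding supported_on_def by blast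
qed

text \<open>A basis modulo the submodule becomes a basis in the sense of linear algebra after restriction, so the
invariance of dimension applies to it.\<close>

lemma basis_mod_restrict:
  fixes C :: "'k::field series2 set"
  assumes C: "basis_mod C (supported_on A) (supported_on B)" and BA: "B \<subseteq> A"
  defines "r \<equiv> restrict_to (A - B)"
  shows "inj_on r C"
    and "module.independent (\<lambda>c f. scalar c * f) (r ` C)"
    and "module.span (\<lambda>c f. scalar c * f) (r ` C) = supported_on (A - B)"
proof -
  interpret vs: vector_space "\<lambda>c (f :: 'k series2). scalar c * f" by (rule vector_space_series2)
  have fin: "finite C" and CA: "C \<subseteq> supported_on A"
    and uniq: "\<And>f. f \<in> supported_on A \<Longrightarrow>
      \<exists>!c. (\<forall>b. b \<notin> C \<longrightarrow> c b = 0) \<and> f - (\<Sum>b\<in>C. scalar (c b) * b) \<in> supported_on B"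
    using C unfolding basis_mod_def by blast+
  have in_A: "(\<Sum>b\<in>C. scalar (u b) * b) \<in> supported_on A" for u
    using CA by (intro supported_on_closed) auto
  have indep: "u b = 0" if s: "(\<Sum>b\<in>C. scalar (u b) * r b) = 0" and b: "b \<in> C" for u b
  proof -
    define P where "P = (\<lambda>c. (\<forall>b. b \<notin> C \<longrightarrow> c b = 0) \<and> 0 - (\<Sum>b\<in>C. scalar (c b) * b) \<in> supported_on B)"
    let ?v = "\<lambda>b. if b \<in> C then - u b else 0"
    have v: "0 - (\<Sum>b\<in>C. scalar (?v b) * b) = (\<Sum>b\<in>C. scalar (u b) * b)"
      by (simp add: scalar_simps sum_negf)
    have "restrict_to (A - B) (\<Sum>b\<in>C. scalar (u b) * b) = 0"
      using s unfolding restrict_to_sum_scaled r_def .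
    then have "(\<Sum>b\<in>C. scalar (u b) * b) \<in> supported_on B"
      using in_supported_on_iff_restrict_eq_0[OF in_A BA] by blast
    then have "P ?v" unfolding P_def v by simp
    moreover have "P (\<lambda>_. 0)" by (simp add: P_def scalar_simps supported_on_closed)
    moreover have "\<exists>!c. P c" unfolding P_def by (rule uniq) (rule supported_on_closed)
    ultimately have "?v = (\<lambda>_. 0)" by blast
    then have "?v b = 0" by (rule fun_cong)
    then show "u b = 0" using b by simp
  qed
  show inj: "inj_on r C"
  proof (rule inj_onI, rule ccontr)
    fix b b' assume b: "b \<in> C" "b' \<in> C" "r b = r b'" "b \<noteq> b'"
    let ?u = "\<lambda>x. if x = b then 1 else if x = b' then - 1 else (0::'k)"
    have "(\<Sum>x\<in>C. scalar (?u x) * r x) = (\<Sum>x\<in>{b, b'}. scalar (?u x) * r x)"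
      using b fin by (intro sum.mono_neutral_right) (auto simp: scalar_simps)
    also have "\<dots> = 0" using b by (simp add: scalar_simps)
    finally have "?u b = 0" by (rule indep[OF _ b(1)])
    then show False by simp
  qed
  show "vs.independent (r ` C)"
  proof (rule vs.independent_if_scalars_zero)
    fix f x assume s: "(\<Sum>x\<in>r ` C. scalar (f x) * x) = 0" and "x \<in> r ` C"
    then obtain b where b: "b \<in> C" "x = r b" by blast
    have "(\<Sum>b\<in>C. scalar (f (r b)) * r b) = 0" using s by (simp add: sum.reindex[OF inj])
    then show "f x = 0" using indep[of "\<lambda>b. f (r b)"] b by blast
  qed (use fin in simp)
  show "vs.span (r ` C) = supported_on (A - B)"
  proof
    have "vs.subspace (supported_on (A - B))"
      by (rule vs.subspaceI) (simp_all add: supported_on_closed)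
    moreover have "r f \<in> supported_on (A - B)" for f
      unfolding supported_on_def by (simp add: r_def)
    ultimately show "vs.span (r ` C) \<subseteq> supported_on (A - B)"
      by (intro vs.span_minimal) auto
    show "supported_on (A - B) \<subseteq> vs.span (r ` C)"
    proof
      fix f :: "'k series2" assume f: "f \<in> supported_on (A - B)"
      have fA: "f \<in> supported_on A" using f by (rule supported_on_mono) blast
      obtain c where c: "f - (\<Sum>b\<in>C. scalar (c b) * b) \<in> supported_on B" using uniq[OF fA] by blast
      have "restrict_to (A - B) (f - (\<Sum>b\<in>C. scalar (c b) * b)) = 0"
        using c in_supported_on_iff_restrict_eq_0[OF supported_on_closed(3)[OF fA in_A] BA] by blast
      moreover have "restrict_to (A - B) (f - g) = f - restrict_to (A - B) g" for g
        by (rule series2_eqI) (simp add: supported_onD[OF f])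
      ultimately have "f = (\<Sum>b\<in>C. scalar (c b) * r b)"
        unfolding r_def by (simp add: restrict_to_sum_scaled)
      also have "\<dots> \<in> vs.span (r ` C)"
        by (intro vs.span_sum vs.span_scale vs.span_base) auto
      finally show "f \<in> vs.span (r ` C)" .
    qed
  qed
qed

lemma basis_mod_monomials:
  assumes BA: "B \<subseteq> A" and fin: "finite (A - B)"
  shows "basis_mod (xmon ` (A - B)) (supported_on A) (supported_on B :: 'k::field series2 set)"
  unfolding basis_mod_def
proof (intro conjI ballI)
  let ?C = "xmon ` (A - B) :: 'k series2 set"
  show "finite ?C" using fin by simp
  show "?C \<subseteq> supported_on A" by auto
  fix f :: "'k series2" assume f: "f \<in> supported_on A"
  have coef: "coef (\<Sum>b\<in>?C. scalar (c b) * b) p = (if p \<in> A - B then c (xmon p) else 0)" for c :: "'k series2 \<Rightarrow> 'k" and p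
  proof -
    have "(\<Sum>b\<in>?C. scalar (c b) * b) = (\<Sum>q\<in>A - B. scalar (c (xmon q)) * xmon q)"
      by (subst sum.reindex) (auto simp: inj_on_def dest: injD[OF inj_xmon])
    then have "coef (\<Sum>b\<in>?C. scalar (c b) * b) p = (\<Sum>q\<in>A - B. if p = q then c (xmon q) else 0)"
      by (simp add: if_distrib cong: if_cong)
    then show ?thesis using fin by simp
  qed
  have iff: "f - (\<Sum>b\<in>?C. scalar (c b) * b) \<in> supported_on B \<longleftrightarrow> (\<forall>p\<in>A - B. c (xmon p) = coef f p)"
    for c :: "'k series2 \<Rightarrow> 'k"
  proof -
    have "coef f p - (if p \<in> A - B then c (xmon p) else 0) = 0 \<longleftrightarrow>
        (p \<in> A - B \<longrightarrow> c (xmon p) = coef f p)" if "p \<notin> B" for p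
      using supported_onD[OF f, of p] that by auto
    then show ?thesis unfolding supported_on_def mem_Collect_eq coef_simps coef by blast
  qed
  show "\<exists>!c. (\<forall>b. b \<notin> ?C \<longrightarrow> c b = 0) \<and> f - (\<Sum>b\<in>?C. scalar (c b) * b) \<in> supported_on B"
    unfolding iff
  proof (rule ex1I[of _ "\<lambda>b. if b \<in> ?C then coef f (inv xmon b) else 0"])
    show "(\<forall>b. b \<notin> ?C \<longrightarrow> (if b \<in> ?C then coef f (inv xmon b) else 0) = 0) \<and>
      (\<forall>p\<in>A - B. (if xmon p \<in> ?C then coef f (inv xmon (xmon p :: 'k series2)) else 0) = coef f p)"
      using inv_f_f[OF inj_xmon, where ?'a1 = 'k] by simp
    fix c :: "'k series2 \<Rightarrow> 'k" assume c: "(\<forall>b. b \<notin> ?C \<longrightarrow> c b = 0) \<and> (\<forall>p\<in>A - B. c (xmon p) = coef f p)"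
    show "c = (\<lambda>b. if b \<in> ?C then coef f (inv xmon b) else 0)"
    proof
      fix b
      show "c b = (if b \<in> ?C then coef f (inv xmon b) else 0)"
        using c inv_f_f[OF inj_xmon, where ?'a1 = 'k] by (cases "b \<in> ?C") auto
    qed
  qed
qed

text \<open>The monomials with exponent in \<open>A - B\<close> are one basis of the quotient, and all bases have the same
cardinality.\<close>

lemma quot_dim_supported_on:
  assumes BA: "B \<subseteq> A" and fin: "finite (A - B)"
  shows "quot_dim (supported_on A) (supported_on B :: 'k::field series2 set) = card (A - B)"
proof -
  interpret vs: vector_space "\<lambda>c (f :: 'k series2). scalar c * f" by (rule vector_space_series2)
  have dim: "card C = vs.dim (supported_on (A - B))"
    if "basis_mod C (supported_on A) (supported_on B)" for C :: "'k series2 set"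
  proof -
    note r = basis_mod_restrict[OF that BA]
    have "vs.dim (supported_on (A - B)) = card (restrict_to (A - B) ` C)"
      using r(2,3) by (metis vs.dim_eq_card vs.span_span)
    then show ?thesis using card_image[OF r(1)] by simp
  qed
  have card: "card (xmon ` (A - B) :: 'k series2 set) = card (A - B)"
    by (intro card_image inj_on_subset[OF inj_xmon]) simp
  show ?thesis
    unfolding quot_dim_def
  proof (rule the_equality)
    show "\<exists>C. basis_mod C (supported_on A) (supported_on B :: 'k series2 set) \<and> card C = card (A - B)"
      using basis_mod_monomials[OF assms] card by blast
    fix d assume "\<exists>C. basis_mod C (supported_on A) (supported_on B :: 'k series2 set) \<and> card C = d"
    then show "d = card (A - B)"
      using dim basis_mod_monomials[OF assms] card by metis
  qed
qed

section \<open>The invariant ring and its modules\<close>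

text \<open>The exponents of the monomials on which the generator of the group acts by the \<open>t\<close>-th power of the root
of unity.\<close>

definition exps :: "nat \<Rightarrow> nat \<Rightarrow> int \<Rightarrow> (nat \<times> nat) set" where
  "exps n a t = {(i, j). [int i + int j * int a = t] (mod int n)}"

lemma exps_iff: "p \<in> exps n a t \<longleftrightarrow> [int (fst p) + int (snd p) * int a = t] (mod int n)"
  by (cases p) (simp add: exps_def)

lemma exps_cong: "[s = t] (mod int n) \<Longrightarrow> exps n a s = exps n a t"
  using cong_trans cong_sym unfolding exps_def by blast

lemma exps_add: 
  assumes "p \<in> exps n a s" "q \<in> exps n a t"
  shows "p + q \<in> exps n a (s + t)"
  using cong_add[OF assms[unfolded exps_iff]] by (simp add: exps_iff algebra_simps)

lemma exps_cancel:
  assumes "p + q \<in> exps n a (s + t)" "p \<in> exps n a s"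
  shows "q \<in> exps n a t"
  using cong_diff[OF assms[unfolded exps_iff]] by (simp add: exps_iff algebra_simps)

lemma exps_0: "0 \<in> exps n a 0"
  by (simp add: exps_iff)

lemma exps_axes: "(n, 0) \<in> exps n a 0" "(0, n) \<in> exps n a 0"
  by (simp_all add: exps_iff cong_def)

lemma sumset_exps: "sumset (exps n a s) (exps n a t) \<subseteq> exps n a (s + t)"
  using exps_add unfolding sumset_def by blast

lemma exps_diff_axes:
  assumes "p \<in> exps n a t"
  shows "(n, 0) \<le> p \<Longrightarrow> p - (n, 0) \<in> exps n a t" "(0, n) \<le> p \<Longrightarrow> p - (0, n) \<in> exps n a t"
  using exps_cancel[of "(n, 0)" "p - (n, 0)" n a 0 t] exps_cancel[of "(0, n)" "p - (0, n)" n a 0 t] 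
    assms exps_axes by (cases p, simp)+

lemma exps_generated:
  assumes n: "n > 0"
  shows "exps n a t = sumset {p \<in> exps n a t. fst p < n \<and> snd p < n} (exps n a 0)"
proof
  show "exps n a t \<subseteq> sumset {p \<in> exps n a t. fst p < n \<and> snd p < n} (exps n a 0)"
  proof
    fix p assume p: "p \<in> exps n a t"
    let ?h = "(n * (fst p div n), n * (snd p div n))" and ?q = "(fst p mod n, snd p mod n)"
    have h: "?h \<in> exps n a 0" by (simp add: exps_iff cong_def mult.assoc)
    have pq: "p = ?q + ?h" by (simp add: prod_eq_iff)
    have "?q \<in> exps n a t" using exps_cancel[of ?h ?q n a 0 t] p h pq by (simp add: add.commute)
    then have "?q \<in> {p \<in> exps n a t. fst p < n \<and> snd p < n}" using n by simp
    then show "p \<in> sumset {p \<in> exps n a t. fst p < n \<and> snd p < n} (exps n a 0)"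
      unfolding sumset_def using h pq by blast
  qed
  show "sumset {p \<in> exps n a t. fst p < n \<and> snd p < n} (exps n a 0) \<subseteq> exps n a t"
    using exps_add[of _ n a t _ 0] unfolding sumset_def by auto
qed

text \<open>A nonzero invariant exponent outside the box can be reduced by \<open>(n, 0)\<close> or \<open>(0, n)\<close>. This gives a finite
system of monomial generators of the maximal ideal.\<close>

lemma nonzero_exps_generated:
  assumes n: "n > 0"
  shows "exps n a 0 - {0} = sumset {p \<in> exps n a 0 - {0}. fst p \<le> n \<and> snd p \<le> n} (exps n a 0)"
proof
  show "exps n a 0 - {0} \<subseteq> sumset {p \<in> exps n a 0 - {0}. fst p \<le> n \<and> snd p \<le> n} (exps n a 0)"
  proof
    fix p assume p: "p \<in> exps n a 0 - {0}"
    have "\<exists>q h. p = q + h \<and> q \<in> exps n a 0 - {0} \<and> fst q \<le> n \<and> snd q \<le> n \<and> h \<in> exps n a 0"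
    proof -
      consider "n \<le> fst p" | "n \<le> snd p" | "fst p \<le> n \<and> snd p \<le> n" by linarith
      then show ?thesis
      proof cases
        case 1
        then have "p = (n, 0) + (p - (n, 0))" "(n, 0) \<le> p" by (simp_all add: prod_eq_iff less_eq_prod_def)
        then show ?thesis using exps_diff_axes(1)[of p n a 0] p n exps_axes(1)[of n a]
          by (intro exI[of _ "(n, 0)"] exI[of _ "p - (n, 0)"]) (simp add: zero_prod_def)
      next
        case 2
        then have "p = (0, n) + (p - (0, n))" "(0, n) \<le> p" by (simp_all add: prod_eq_iff less_eq_prod_def)
        then show ?thesis using exps_diff_axes(2)[of p n a 0] p n exps_axes(2)[of n a]
          by (intro exI[of _ "(0, n)"] exI[of _ "p - (0, n)"]) (simp add: zero_prod_def)
      next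
        case 3
        then show ?thesis using p exps_0 by (intro exI[of _ p] exI[of _ 0]) simp
      qed
    qed
    then show "p \<in> sumset {p \<in> exps n a 0 - {0}. fst p \<le> n \<and> snd p \<le> n} (exps n a 0)"
      unfolding sumset_def by blast
  qed
  show "sumset {p \<in> exps n a 0 - {0}. fst p \<le> n \<and> snd p \<le> n} (exps n a 0) \<subseteq> exps n a 0 - {0}"
  proof
    fix p assume "p \<in> sumset {p \<in> exps n a 0 - {0}. fst p \<le> n \<and> snd p \<le> n} (exps n a 0)"
    then obtain q h where p: "p = q + h" "q \<in> exps n a 0" "q \<noteq> 0" "h \<in> exps n a 0"
      unfolding sumset_def by blast
    then have "p \<in> exps n a 0" using exps_add[of q n a 0 h 0] by simp
    moreover have "p \<noteq> 0" using p(3) unfolding p(1) by (auto simp: prod_eq_iff)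
    ultimately show "p \<in> exps n a 0 - {0}" by simp
  qed
qed

lemma finite_box: "finite {p \<in> A. fst p < n \<and> snd p < (n :: nat)}"
  by (rule finite_subset[of _ "{..n} \<times> {..n}"]) auto

lemma finite_bounded: "finite {p :: nat \<times> nat. P p \<and> fst p \<le> n \<and> snd p \<le> n}"
  by (rule finite_subset[of _ "{..n} \<times> {..n}"]) auto

lemma supported_on_power:
  assumes "f \<in> supported_on (exps n a t)"
  shows "f ^ k \<in> supported_on (exps n a (int k * t))"
proof (induction k)
  case 0
  then show ?case using xmon_in_supported_on[of 0 "exps n a 0"] by (simp add: exps_0 xmon_0)
next
  case (Suc k)
  have "f * f ^ k \<in> supported_on (sumset (exps n a t) (exps n a (int k * t)))"
    by (rule supported_on_mult[OF assms Suc])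
  moreover have "sumset (exps n a t) (exps n a (int k * t)) \<subseteq> exps n a (int (Suc k) * t)"
    using sumset_exps[of n a t "int k * t"] by (simp add: algebra_simps)
  ultimately show ?case unfolding power_Suc by (rule supported_on_mono)
qed

text \<open>Primitivity of \<open>z\<close> turns invariance under the group into a congruence for exponents. Coprimality of \<open>a\<close> and
\<open>n\<close> provides a power of \<open>y\<close> of every weight.\<close>

locale cyclic_action =
  fixes n a :: nat and z :: "'k::field"
  assumes n_pos: "n > 0" and coprime: "coprime a n" and prim: "primitive_root_of_unity n z"
begin

lemma root_power_eq_1_iff: "z ^ m = 1 \<longleftrightarrow> n dvd m"
proof -
  have zn: "z ^ n = 1" and min: "\<And>m. 0 < m \<Longrightarrow> m < n \<Longrightarrow> z ^ m \<noteq> 1"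
    using prim unfolding primitive_root_of_unity_def by blast+
  have "z ^ m = z ^ (n * (m div n) + m mod n)" by simp
  also have "\<dots> = z ^ (m mod n)" by (simp only: power_add power_mult zn power_one mult_1)
  finally have "z ^ m = 1 \<longleftrightarrow> z ^ (m mod n) = 1" by simp
  also have "\<dots> \<longleftrightarrow> m mod n = 0" using min[of "m mod n"] n_pos by (cases "m mod n = 0") auto
  finally show ?thesis by (simp add: dvd_eq_mod_eq_0)
qed

lemma invariant_ring_eq: "invariant_ring z a = supported_on (exps n a 0)"
proof -
  have weight: "p \<in> exps n a 0 \<longleftrightarrow> z ^ (fst p + a * snd p) = 1" for p
  proof -
    have "[int (fst p) + int (snd p) * int a = 0] (mod int n) \<longleftrightarrow> int n dvd int (fst p + a * snd p)"
      by (simp add: cong_0_iff mult.commute)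
    then show ?thesis unfolding exps_iff root_power_eq_1_iff by (simp only: int_dvd_int_iff)
  qed
  have act: "coef (act z a f) p = z ^ (fst p + a * snd p) * coef f p" for f p
    by (simp add: act_def coef_def power_add power_mult)
  have "(\<forall>l. (act z a ^^ l) f = f) \<longleftrightarrow> act z a f = f" for f
  proof
    assume "\<forall>l. (act z a ^^ l) f = f"
    then have "(act z a ^^ 1) f = f" by blast
    then show "act z a f = f" by simp
  next
    assume "act z a f = f"
    then have "(act z a ^^ l) f = f" for l by (induction l) auto
    then show "\<forall>l. (act z a ^^ l) f = f" by blast
  qed
  moreover have "act z a f = f \<longleftrightarrow> (\<forall>p. z ^ (fst p + a * snd p) * coef f p = coef f p)" for f
    using series2_eqI[of "act z a f" f] by (metis act)
  ultimately show ?thesis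
    unfolding invariant_ring_def supported_on_def weight by (auto simp: algebra_simps)
qed

lemma M_mod_eq: "M_mod n a z t = supported_on (exps n a t)"
proof
  let ?F = "{p \<in> exps n a t. fst p < n \<and> snd p < n}"
  have X: "{mon i j :: 'k series2 | i j. [int i + int j * int a = t] (mod int n)} = xmon ` exps n a t"
    by (force simp: xmon_def exps_def image_iff)
  have "finite ?F" by (rule finite_box)
  then have "rspan (supported_on (exps n a 0)) (xmon ` ?F) = (supported_on (exps n a t) :: 'k series2 set)"
    using rspan_supported_on[of ?F "exps n a 0"] sumset_exps[of n a 0 0]
    unfolding exps_generated[OF n_pos, of a t, symmetric] by simp
  then show "supported_on (exps n a t) \<subseteq> M_mod n a z t"
    unfolding M_mod_def X invariant_ring_eq
    by (metis (no_types, lifting) image_mono mem_Collect_eq rspan_mono subsetI)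
  show "M_mod n a z t \<subseteq> supported_on (exps n a t)"
    unfolding M_mod_def X invariant_ring_eq
    using sumset_exps[of n a 0 t] by (intro rspan_le_supported_on) auto
qed

text \<open>An invariant series with nonzero constant term has an inverse in the power series ring. The part of this
inverse with invariant exponents is again an inverse, because multiplication by an invariant series
respects the decomposition by weights.\<close>

lemma max_ideal_eq: "max_ideal (invariant_ring z a) = supported_on (exps n a 0 - {0})"
proof
  show "max_ideal (invariant_ring z a) \<subseteq> supported_on (exps n a 0 - {0})"
  proof
    fix f assume "f \<in> max_ideal (invariant_ring z a)"
    then have f: "f \<in> supported_on (exps n a 0)" and nonunit: "\<And>g. g \<in> supported_on (exps n a 0) \<Longrightarrow> f * g \<noteq> 1"
      unfolding max_ideal_def invariant_ring_eq by auto
    have "coef f 0 = 0"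
    proof (rule ccontr)
      assume "coef f 0 \<noteq> 0"
      then have "f $ 0 * inverse (f $ 0) = 1"
        by (simp add: coef_def inverse_mult_eq_1')
      then obtain g where g: "f * g = 1" using fps_right_inverse by blast
      let ?g = "restrict_to (exps n a 0) g"
      have "f * ?g = 1"
      proof (rule series2_eqI)
        fix p
        have inner: "coef f (i, j) * coef ?g (p - (i, j)) =
            (if p \<in> exps n a 0 then coef f (i, j) * coef g (p - (i, j)) else 0)" if "i \<le> fst p" "j \<le> snd p" for i j
        proof (cases "(i, j) \<in> exps n a 0")
          case True
          have "(i, j) + (p - (i, j)) = p" using that by (simp add: prod_eq_iff)
          then have "p - (i, j) \<in> exps n a 0 \<longleftrightarrow> p \<in> exps n a 0"
            using exps_add[OF True, of "p - (i, j)" 0] exps_cancel[of "(i, j)" "p - (i, j)" n a 0 0] True by auto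
          then show ?thesis by simp
        qed (simp add: supported_onD[OF f])
        have "coef (f * ?g) p = (\<Sum>j=0..snd p. \<Sum>i=0..fst p.
            if p \<in> exps n a 0 then coef f (i, j) * coef g (p - (i, j)) else 0)"
          unfolding coef_mult by (intro sum.cong refl) (use inner in auto)
        also have "\<dots> = (if p \<in> exps n a 0 then coef (f * g) p else 0)"
          unfolding coef_mult by simp
        also have "\<dots> = coef 1 p" using exps_0 unfolding g by simp
        finally show "coef (f * ?g) p = coef 1 p" .
      qed
      moreover have "?g \<in> supported_on (exps n a 0)" unfolding supported_on_def by simp
      ultimately show False using nonunit by blast
    qed
    then show "f \<in> supported_on (exps n a 0 - {0})"
      using supported_onD[OF f] unfolding supported_on_def by blast
  qed
  show "supported_on (exps n a 0 - {0}) \<subseteq> max_ideal (invariant_ring z a)"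
  proof
    fix f :: "'k series2" assume f: "f \<in> supported_on (exps n a 0 - {0})"
    have "coef (f * g) 0 = 0" for g using supported_onD[OF f, of "(0, 0)"] by (simp add: coef_mult zero_prod_def)
    then have "f * g \<noteq> 1" for g by (metis coef_1 zero_neq_one)
    then show "f \<in> max_ideal (invariant_ring z a)"
      unfolding max_ideal_def invariant_ring_eq
      using supported_on_mono[OF f] by blast
  qed
qed

end

text \<open>A power of \<open>x\<close> and a power of \<open>y\<close> are coprime, which is seen on the coefficients by a comparison of
supports.\<close>

lemma x_power_divides:
  assumes "xmon (i, 0) * g = xmon (0, j) * f"
  shows "\<exists>h. f = xmon (i, 0) * h"
proof
  let ?h = "series_of (\<lambda>p. coef f (p + (i, 0)))"
  have f0: "coef f p = 0" if "\<not> (i, 0) \<le> p" for p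
  proof -
    have "coef (xmon (0, j) * f) (p + (0, j)) = coef f p" by (simp add: coef_xmon_mult less_eq_prod_def)
    moreover have "coef (xmon (i, 0) * g) (p + (0, j)) = 0"
      using that by (simp add: coef_xmon_mult less_eq_prod_def)
    ultimately show ?thesis using assms by simp
  qed
  show "f = xmon (i, 0) * ?h"
  proof (rule series2_eqI)
    fix p :: "nat \<times> nat"
    have "p - (i, 0) + (i, 0) = p" if "(i, 0) \<le> p" using that by (simp add: prod_eq_iff less_eq_prod_def)
    then show "coef f p = coef (xmon (i, 0) * ?h) p"
      using f0[of p] by (simp add: coef_xmon_mult)
  qed
qed

definition int_point :: "nat \<times> nat \<Rightarrow> int \<times> int" where
  "int_point p = (int (fst p), int (snd p))"

lemma inj_int_point: "inj int_point"
  by (auto simp: inj_on_def int_point_def prod_eq_iff)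

lemma image_int_point_exps: "int_point ` exps n a t = coset_points (int n) (int a) t"
proof (intro equalityI subsetI)
  fix p assume "p \<in> coset_points (int n) (int a) t"
  then have "p = int_point (nat (fst p), nat (snd p))" "(nat (fst p), nat (snd p)) \<in> exps n a t"
    by (auto simp: coset_points_def int_point_def exps_iff cong_iff_dvd_diff mult.commute)
  then show "p \<in> int_point ` exps n a t" by (rule image_eqI)
qed (auto simp: coset_points_def int_point_def exps_iff cong_iff_dvd_diff mult.commute)

lemma image_int_point_sumset: "int_point ` sumset A B = sumset (int_point ` A) (int_point ` B)"
proof -
  have add: "int_point (p + q) = int_point p + int_point q" for p q
    by (simp add: int_point_def)
  show ?thesis
  proof (intro equalityI subsetI)
    fix x assume "x \<in> int_point ` sumset A B"
    then obtain s where s: "x = int_point s" "s \<in> sumset A B" by blast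
    then obtain p q where "s = p + q" "p \<in> A" "q \<in> B" unfolding sumset_def by blast
    moreover from this have "x = int_point p + int_point q" by (simp only: s add)
    ultimately show "x \<in> sumset (int_point ` A) (int_point ` B)" unfolding sumset_def by blast
  next
    fix x assume "x \<in> sumset (int_point ` A) (int_point ` B)"
    then obtain p q where pq: "x = int_point p + int_point q" "p \<in> A" "q \<in> B"
      unfolding sumset_def by blast
    then have "p + q \<in> sumset A B" unfolding sumset_def by blast
    moreover have "x = int_point (p + q)" by (simp only: pq add)
    ultimately show "x \<in> int_point ` sumset A B" by blast
  qed
qed

lemma image_int_point_layer:
  "int_point ` ((sumset (exps n a 0 - {0}) ^^ l) (exps n a t)) = layer (int n) (int a) t l"
proof (induction l)
  case 0
  then show ?case by (simp add: layer_0 image_int_point_exps)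
next
  case (Suc l)
  have "int_point ` (exps n a 0 - {0}) = coset_points (int n) (int a) 0 - {0}"
    unfolding image_set_diff[OF inj_int_point] image_int_point_exps by (simp add: int_point_def zero_prod_def)
  then show ?case by (simp only: funpow.simps o_apply image_int_point_sumset Suc layer_Suc)
qed

context cyclic_action
begin

text \<open>The induction needs that all layers are finitely generated over the monoid of invariant exponents.\<close>

lemma ideal_mult_power_eq:
  "(ideal_mult (invariant_ring z a) (max_ideal (invariant_ring z a)) ^^ l) (M_mod n a z t)
    = supported_on ((sumset (exps n a 0 - {0}) ^^ l) (exps n a t))"
proof -
  let ?H = "exps n a 0" and ?T = "\<lambda>l. (sumset (exps n a 0 - {0}) ^^ l) (exps n a t)"
  let ?G = "{p \<in> ?H - {0}. fst p \<le> n \<and> snd p \<le> n}"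
  have G: "finite ?G" "?H - {0} = sumset ?G ?H"
    by (rule finite_bounded, rule nonzero_exps_generated[OF n_pos])
  have HH: "sumset ?H ?H = ?H" by (rule sumset_submonoid[OF exps_0]) (use sumset_exps[of n a 0 0] in simp)
  have fg: "\<exists>F. finite F \<and> ?T l = sumset F ?H" for l
  proof (induction l)
    case 0
    have "?T 0 = sumset {p \<in> exps n a t. fst p < n \<and> snd p < n} ?H"
      using exps_generated[OF n_pos, of a t] by (simp only: funpow_0)
    then show ?case using finite_box[of "exps n a t" n] by blast
  next
    case (Suc l)
    then obtain F where F: "finite F" "?T l = sumset F ?H" by blast
    have "?T (Suc l) = sumset (?H - {0}) (?T l)" by simp
    also have "\<dots> = sumset (sumset ?G ?H) (sumset F ?H)" by (simp only: F(2) G(2)[symmetric])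
    also have "\<dots> = sumset (sumset ?G F) ?H" by (rule sumset_generated[OF HH])
    finally show ?case using finite_sumset[OF G(1) F(1)] by blast
  qed
  show ?thesis
  proof (induction l)
    case 0
    then show ?case by (simp add: M_mod_eq)
  next
    case (Suc l)
    obtain F where F: "finite F" "?T l = sumset F ?H" using fg by blast
    have "ideal_mult (supported_on ?H) (supported_on (?H - {0})) (supported_on (?T l))
        = (supported_on (sumset (?H - {0}) (?T l)) :: 'k series2 set)"
      by (rule ideal_mult_supported_on[OF exps_0 _ G F]) (simp add: HH)
    then show ?case using Suc by (simp only: funpow.simps o_apply invariant_ring_eq max_ideal_eq[unfolded invariant_ring_eq])
  qed
qed

lemma card_exps_minus_layer:
  "card (exps n a t - (sumset (exps n a 0 - {0}) ^^ l) (exps n a t)) =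
    card (coset_points (int n) (int a) t - layer (int n) (int a) t l)"
proof -
  have "int_point ` (exps n a t - (sumset (exps n a 0 - {0}) ^^ l) (exps n a t))
      = coset_points (int n) (int a) t - layer (int n) (int a) t l"
    by (simp add: image_set_diff[OF inj_int_point] image_int_point_exps image_int_point_layer)
  then show ?thesis
    using card_image[OF inj_on_subset[OF inj_int_point subset_UNIV]] by metis
qed

lemma quot_dim_M_mod:
  assumes "finite (coset_points (int n) (int a) t - layer (int n) (int a) t l)"
  shows "quot_dim (M_mod n a z t)
      ((ideal_mult (invariant_ring z a) (max_ideal (invariant_ring z a)) ^^ l) (M_mod n a z t))
    = card (coset_points (int n) (int a) t - layer (int n) (int a) t l)"
proof -
  let ?T = "(sumset (exps n a 0 - {0}) ^^ l) (exps n a t)"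
  have "layer (int n) (int a) t l \<subseteq> coset_points (int n) (int a) t"
    using layer_decreasing[of "int n" "int a" t 0 l] by (simp add: layer_0)
  then have "?T \<subseteq> exps n a t"
    unfolding image_int_point_layer[symmetric] image_int_point_exps[symmetric]
    using inj_image_subset_iff[OF inj_int_point] by blast
  moreover have "finite (exps n a t - ?T)"
  proof (rule finite_imageD)
    show "finite (int_point ` (exps n a t - ?T))"
      using assms by (simp add: image_set_diff[OF inj_int_point] image_int_point_exps image_int_point_layer)
    show "inj_on int_point (exps n a t - ?T)" using inj_int_point inj_on_subset by blast
  qed
  ultimately show ?thesis
    unfolding ideal_mult_power_eq unfolding M_mod_eq card_exps_minus_layer[symmetric]
    by (rule quot_dim_supported_on)
qed

text \<open>The points of the class that are not in layer \<open>1\<close> are the minimal points.\<close>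

lemma num_gens_M_mod: "num_gens (invariant_ring z a) (M_mod n a z t) = card (min_points (int n) (int a) t)"
proof -
  have min: "coset_points (int n) (int a) t - layer (int n) (int a) t 1 = min_points (int n) (int a) t"
    using coset_minus_sumset_eq_min_points by (simp add: layer_def)
  have "finite (min_points (int n) (int a) t)" using finite_min_points n_pos by simp
  then show ?thesis using quot_dim_M_mod[of t 1] unfolding min num_gens_def by simp
qed

lemma multiplicity_of_M_mod:
  assumes "\<forall>c\<in>set cs. c \<ge> 2" "cs \<noteq> []" "int n = hj_num cs" "int a = hj_den cs"
  shows "multiplicity_of (invariant_ring z a) (M_mod n a z t) = real (nat (\<Sum>c\<leftarrow>cs. c - 2) + 2)"
proof -
  have "quot_dim (M_mod n a z t)
      ((ideal_mult (invariant_ring z a) (max_ideal (invariant_ring z a)) ^^ l) (M_mod n a z t))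
    = card (coset_points (int n) (int a) t - layer (int n) (int a) t l)" for l
    using card_coset_minus_layer(1)[OF assms(1,2)] unfolding assms(3,4)[symmetric]
    by (rule quot_dim_M_mod)
  then show ?thesis
    unfolding multiplicity_of_def
    using layer_count_limit[OF assms(1,2), of t] assms(3,4) by (intro limI) simp
qed

lemma rspan_monomials: "finite F \<Longrightarrow> rspan (invariant_ring z a) (xmon ` F) = supported_on (sumset F (exps n a 0))"
  unfolding invariant_ring_eq using rspan_supported_on sumset_exps[of n a 0 0] by simp

text \<open>The regular sequence is \<open>x\<^sup>n, y\<^sup>n\<close>: multiplication by a monomial translates supports, and a point of the
class lies in the translate by \<open>(n, 0)\<close> iff its first coordinate is at least \<open>n\<close>.\<close>

lemma mcm_M_mod: "mcm (invariant_ring z a) (M_mod n a z t)"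
  unfolding mcm_def
proof (intro conjI)
  let ?R = "invariant_ring z a" and ?H = "exps n a 0"
  let ?F = "{p \<in> exps n a t. fst p < n \<and> snd p < n}"
  have F: "finite ?F" "exps n a t = sumset ?F ?H"
    by (rule finite_box, rule exps_generated[OF n_pos])
  have mult: "r * f \<in> supported_on (exps n a t)" if "r \<in> supported_on ?H" "f \<in> supported_on (exps n a t)"
    for r f :: "'k series2"
    using supported_on_mult[OF that] sumset_exps[of n a 0 t] by (auto intro: supported_on_mono)
  show "rsubmodule ?R (M_mod n a z t)"
    unfolding rsubmodule_def invariant_ring_eq M_mod_eq by (auto simp: supported_on_closed mult)
  have "M_mod n a z t = rspan ?R (xmon ` ?F)" using rspan_monomials[OF F(1)] F(2) M_mod_eq by simp
  then show "fin_gen ?R (M_mod n a z t)" unfolding fin_gen_def using F(1) by blast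
  let ?fs = "[xmon (n, 0), xmon (0, n)] :: 'k series2 list"
  have idl: "ideal_mult ?R (rspan ?R (xmon ` G)) (M_mod n a z t)
      = (supported_on (sumset (sumset G ?H) (exps n a t)) :: 'k series2 set)" if "finite G" for G
    unfolding rspan_monomials[OF that] unfolding invariant_ring_eq M_mod_eq
    by (rule ideal_mult_supported_on[OF exps_0 _ that refl F]) (use sumset_exps[of n a 0 0] in simp)
  have cancel: "h \<in> supported_on X"
    if h: "h \<in> supported_on (exps n a t)" "xmon v * h \<in> supported_on X"
      and X: "\<And>p. p \<in> exps n a t \<Longrightarrow> p + v \<in> X \<Longrightarrow> p \<in> X" for v X and h :: "'k series2"
    unfolding supported_on_def
  proof (intro CollectI allI impI)
    fix p assume p: "p \<notin> X"
    show "coef h p = 0"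
    proof (cases "p \<in> exps n a t")
      case True
      then have "coef (xmon v * h) (p + v) = 0" using X p supported_onD[OF h(2)] by blast
      then show ?thesis by (simp add: coef_xmon_mult less_eq_prod_def)
    qed (rule supported_onD[OF h(1)])
  qed
  show "\<exists>fs. length fs = 2 \<and> set fs \<subseteq> max_ideal ?R \<and> regular_sequence ?R (M_mod n a z t) fs"
  proof (intro exI conjI)
    show "length ?fs = 2" by simp
    show "set ?fs \<subseteq> max_ideal ?R"
      using n_pos exps_axes unfolding max_ideal_eq by (simp add: zero_prod_def)
    show "regular_sequence ?R (M_mod n a z t) ?fs"
      unfolding regular_sequence_def
    proof (intro conjI allI impI ballI)
      let ?X = "sumset (sumset {(n, 0), (0, n)} ?H) (exps n a t)"
      let ?p = "(nat (t mod int n), 0)"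
      have "?p \<in> exps n a t" using n_pos by (simp add: exps_iff cong_def)
      moreover have "?p \<notin> ?X"
      proof
        assume "?p \<in> ?X"
        then have "n \<le> fst ?p \<or> n \<le> snd ?p" unfolding sumset_def by (auto simp: prod_eq_iff)
        moreover have "fst ?p < n" "snd ?p < n" using n_pos by (simp_all add: nat_less_iff)
        ultimately show False by (metis not_le)
      qed
      ultimately have "supported_on ?X \<noteq> (supported_on (exps n a t) :: 'k series2 set)"
        unfolding supported_on_eq_iff by blast
      moreover have "set ?fs = xmon ` {(n, 0), (0, n)}" by simp
      ultimately show "ideal_mult ?R (rspan ?R (set ?fs)) (M_mod n a z t) \<noteq> M_mod n a z t"
        using idl[of "{(n, 0), (0, n)}"] by (simp only: M_mod_eq) simp
    next
      fix i and h :: "'k series2"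
      assume i: "i < length ?fs" and h: "h \<in> M_mod n a z t"
        and fh: "?fs ! i * h \<in> ideal_mult ?R (rspan ?R (set (take i ?fs))) (M_mod n a z t)"
      note h' = h[unfolded M_mod_eq]
      consider "i = 0" | "i = 1" using i by fastforce
      then show "h \<in> ideal_mult ?R (rspan ?R (set (take i ?fs))) (M_mod n a z t)"
      proof cases
        case 1
        have "ideal_mult ?R (rspan ?R (set (take i ?fs))) (M_mod n a z t) = supported_on (sumset (sumset {} ?H) (exps n a t))"
          using idl[of "{}"] 1 by simp
        moreover have "sumset (sumset {} ?H) (exps n a t) = {}" by (simp add: sumset_def)
        ultimately show ?thesis using cancel[OF h', of "(n, 0)" "{}"] fh 1 by simp
      next
        case 2
        let ?X = "sumset (sumset {(n, 0)} ?H) (exps n a t)"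
        have X: "ideal_mult ?R (rspan ?R (set (take i ?fs))) (M_mod n a z t) = supported_on ?X"
          using idl[of "{(n, 0)}"] 2 by simp
        have "p \<in> ?X" if p: "p \<in> exps n a t" "p + (0, n) \<in> ?X" for p
        proof -
          have le: "(n, 0) \<le> p" using p(2) unfolding sumset_def by (auto simp: prod_eq_iff less_eq_prod_def)
          have "p = ((n, 0) + 0) + (p - (n, 0))" using le by (simp add: prod_eq_iff less_eq_prod_def)
          then show ?thesis using exps_diff_axes(1)[OF p(1) le] exps_0[of n a] unfolding sumset_def by blast
        qed
        then show ?thesis using cancel[OF h', of "(0, n)" ?X] fh unfolding X by (simp add: 2)
      qed
    qed
  qed
qed

text \<open>The modules have rank one: for nonzero \<open>f\<close> and \<open>g\<close> of the same weight, \<open>g f\<^bsup>n-1\<^esup> \<cdot> f = f\<^sup>n \<cdot> g\<close> is a nonzero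
common multiple with invariant factors. So two nonzero submodules cannot intersect in zero.\<close>

lemma indecomposable_M_mod: "indecomposable (invariant_ring z a) (M_mod n a z t)"
  unfolding indecomposable_def
proof (intro conjI notI)
  assume "M_mod n a z t = {0}"
  moreover have "xmon (nat (t mod int n), 0) \<in> M_mod n a z t"
    using n_pos by (simp add: M_mod_eq exps_iff cong_def)
  moreover have "xmon p \<noteq> (0 :: 'k series2)" for p
    by (metis coef_simps(1) coef_xmon zero_neq_one)
  ultimately show False by blast
next
  assume "\<exists>A B. rsubmodule (invariant_ring z a) A \<and> rsubmodule (invariant_ring z a) B \<and> A \<noteq> {0} \<and>
    B \<noteq> {0} \<and> A \<inter> B = {0} \<and> {f + g |f g. f \<in> A \<and> g \<in> B} = M_mod n a z t"
  then obtain A B where A: "rsubmodule (invariant_ring z a) A" "A \<noteq> {0}"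
    and B: "rsubmodule (invariant_ring z a) B" "B \<noteq> {0}"
    and AB: "A \<inter> B = {0}" "{f + g |f g. f \<in> A \<and> g \<in> B} = M_mod n a z t" by blast
  have zero: "0 \<in> A" "0 \<in> B" using A B unfolding rsubmodule_def by blast+
  then obtain f g where f: "f \<in> A" "f \<noteq> 0" and g: "g \<in> B" "g \<noteq> 0" using A(2) B(2) by blast
  have "f = f + 0" "g = 0 + g" by simp_all
  then have "f \<in> M_mod n a z t" "g \<in> M_mod n a z t" using f g zero unfolding AB(2)[symmetric] by blast+
  then have fg: "f \<in> supported_on (exps n a t)" "g \<in> supported_on (exps n a t)" by (simp_all add: M_mod_eq)
  let ?r = "g * f ^ (n - 1)" and ?s = "f ^ n"
  have mult_n: "exps n a (int n * t) = exps n a 0" by (rule exps_cong) (simp add: cong_0_iff)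
  have "t + int (n - 1) * t = int n * t" using n_pos by (simp add: of_nat_diff algebra_simps)
  then have "?r \<in> supported_on (exps n a (int n * t))"
    using supported_on_mult[OF fg(2) supported_on_power[OF fg(1), of "n - 1"]] sumset_exps[of n a t "int (n - 1) * t"]
    by (metis supported_on_mono)
  then have "?r \<in> invariant_ring z a" "?s \<in> invariant_ring z a"
    using supported_on_power[OF fg(1), of n] by (simp_all only: mult_n invariant_ring_eq)
  then have "?r * f \<in> A" "?s * g \<in> B" using A(1) B(1) f g unfolding rsubmodule_def by blast+
  moreover have "?r * f = ?s * g" using n_pos by (cases n) (simp_all add: mult_ac)
  ultimately have "?s * g = 0" using AB(1) by (metis IntI singletonD)
  then show False using f g by simp
qed

text \<open>A homomorphism \<open>\<phi>\<close> between these modules satisfies \<open>f \<cdot> \<phi> g = g \<cdot> \<phi> f\<close>, as one sees after multiplication by a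
power of \<open>g\<close> that makes the factors invariant. Applied to a power of \<open>x\<close> and a power of \<open>y\<close> in the source,
this shows that \<open>\<phi>\<close> is multiplication by a series \<open>h\<close>. If \<open>\<phi>\<close> is surjective, then \<open>h\<close> divides a power of
\<open>x\<close> and a power of \<open>y\<close>, hence is a unit, and its constant term shows that source and target have the same
weight.\<close>

lemma module_iso_M_mod:
  assumes iso: "module_iso (invariant_ring z a) (M_mod n a z s) (M_mod n a z t)"
  shows "[s = t] (mod int n)"
proof -
  obtain \<phi> where bij: "bij_betw \<phi> (M_mod n a z s) (M_mod n a z t)"
    and lin: "\<And>r f. r \<in> invariant_ring z a \<Longrightarrow> f \<in> M_mod n a z s \<Longrightarrow> \<phi> (r * f) = r * \<phi> f"
    using iso unfolding module_iso_def by blast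
  have swap: "f * \<phi> g = g * \<phi> f" if "f \<in> M_mod n a z s" "g \<in> M_mod n a z s" "g \<noteq> 0" for f g
  proof -
    have fg: "f \<in> supported_on (exps n a s)" "g \<in> supported_on (exps n a s)" using that by (simp_all add: M_mod_eq)
    have mult_n: "exps n a (int n * s) = exps n a 0" by (rule exps_cong) (simp add: cong_0_iff)
    have "s + int (n - 1) * s = int n * s" using n_pos by (simp add: of_nat_diff algebra_simps)
    then have "f * g ^ (n - 1) \<in> supported_on (exps n a (int n * s))"
      using supported_on_mult[OF fg(1) supported_on_power[OF fg(2), of "n - 1"]] sumset_exps[of n a s "int (n - 1) * s"]
      by (metis supported_on_mono)
    then have R: "f * g ^ (n - 1) \<in> invariant_ring z a" "g ^ n \<in> invariant_ring z a"
      using supported_on_power[OF fg(2), of n] by (simp_all only: mult_n invariant_ring_eq)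
    have gn: "g ^ n = g ^ (n - 1) * g" using n_pos by (cases n) simp_all
    have "(f * g ^ (n - 1)) * \<phi> g = \<phi> ((f * g ^ (n - 1)) * g)" using lin[OF R(1) that(2)] by simp
    also have "(f * g ^ (n - 1)) * g = g ^ n * f" by (simp only: gn mult_ac)
    also have "\<phi> \<dots> = g ^ n * \<phi> f" using lin[OF R(2) that(1)] .
    finally have "g ^ (n - 1) * (f * \<phi> g) = g ^ (n - 1) * (g * \<phi> f)" by (simp only: gn mult_ac)
    then show ?thesis using that(3) by simp
  qed
  define i where "i = nat (s mod int n)"
  have x: "(i, 0) \<in> exps n a s" using n_pos by (simp add: i_def exps_iff cong_def)
  obtain b where b: "[int a * b = 1] (mod int n)"
    using cong_solve_coprime_int coprime by (metis coprime_int_iff)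
  define j where "j = nat (s * b mod int n)"
  have y: "(0, j) \<in> exps n a s"
  proof -
    have "[int j * int a = s * b * int a] (mod int n)"
      using n_pos by (intro cong_mult cong_refl) (simp add: j_def cong_def)
    also have "[s * (int a * b) = s * 1] (mod int n)" using b by (intro cong_mult cong_refl)
    then have "[s * b * int a = s] (mod int n)" by (simp add: mult_ac)
    finally show ?thesis by (simp add: exps_iff)
  qed
  have xM: "xmon (i, 0) \<in> M_mod n a z s" "xmon (0, j) \<in> M_mod n a z s" using x y by (simp_all add: M_mod_eq)
  have xn0: "xmon p \<noteq> (0 :: 'k series2)" for p
    by (metis coef_simps(1) coef_xmon zero_neq_one)
  let ?px = "\<phi> (xmon (i, 0))" and ?py = "\<phi> (xmon (0, j))"
  have eq: "xmon (i, 0) * ?py = xmon (0, j) * ?px" using swap[OF xM(1) xM(2) xn0] .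
  obtain h where px: "?px = xmon (i, 0) * h" using x_power_divides[OF eq] by blast
  have phi: "\<phi> g = g * h" if "g \<in> M_mod n a z s" for g
  proof -
    have "xmon (i, 0) * \<phi> g = g * ?px"
    proof (cases "g = 0")
      case True
      have "\<phi> (0 * xmon (i, 0)) = 0 * \<phi> (xmon (i, 0))"
        using xM by (intro lin) (simp_all add: invariant_ring_eq supported_on_closed)
      then show ?thesis using True by simp
    qed (rule swap[OF xM(1) that])
    then have "xmon (i, 0) * \<phi> g = xmon (i, 0) * (g * h)" by (simp only: px mult_ac)
    then show ?thesis using xn0 by simp
  qed
  \<comment> \<open>The powers of \<open>x\<close> and \<open>y\<close> used here lie in the target.\<close>
  have h0: "coef h 0 \<noteq> 0"
  proof
    assume h0: "coef h 0 = 0"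
    let ?p = "(nat (t mod int n), 0)"
    define k where "k = nat (t * b mod int n)"
    have "?p \<in> exps n a t" using n_pos by (simp add: exps_iff cong_def)
    then have "xmon ?p \<in> M_mod n a z t" by (simp add: M_mod_eq)
    then obtain f where f: "f \<in> M_mod n a z s" "xmon ?p = f * h"
      using bij phi unfolding bij_betw_def by (metis imageE)
    have "[int k * int a = t * b * int a] (mod int n)"
      using n_pos by (intro cong_mult cong_refl) (simp add: k_def cong_def)
    also have "[t * (int a * b) = t * 1] (mod int n)" using b by (intro cong_mult cong_refl)
    then have "[t * b * int a = t] (mod int n)" by (simp add: mult_ac)
    finally have "(0, k) \<in> exps n a t" by (simp add: exps_iff)
    then have "xmon (0, k) \<in> M_mod n a z t" by (simp add: M_mod_eq)
    then obtain g where g: "g \<in> M_mod n a z s" "xmon (0, k) = g * h"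
      using bij phi unfolding bij_betw_def by (metis imageE)
    have "xmon (0, k) * f * h = xmon ?p * g * h" using f(2) g(2) by (metis mult.commute mult.left_commute)
    moreover have "h \<noteq> 0" using f(2) xn0 by auto
    ultimately have "xmon ?p * g = xmon (0, k) * f" by simp
    then obtain f' where f': "f = xmon ?p * f'" using x_power_divides by blast
    have "xmon ?p * 1 = xmon ?p * (f' * h)" using f(2) unfolding f' by (simp only: mult.assoc mult_1_right)
    then have "f' * h = 1" using xn0 mult_left_cancel by metis
    then have "coef (f' * h) 0 = 1" by simp
    then show False using h0 by (simp add: coef_mult zero_prod_def)
  qed
  have "(i, 0) \<in> exps n a t"
  proof (rule ccontr)
    assume "(i, 0) \<notin> exps n a t"
    moreover have "?px \<in> supported_on (exps n a t)"
      using bij xM(1) M_mod_eq unfolding bij_betw_def by blast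
    ultimately have "coef ?px (i, 0) = 0" using supported_onD by blast
    then show False using h0 by (simp add: px coef_xmon_mult zero_prod_def)
  qed
  then show ?thesis using x unfolding exps_iff using cong_trans cong_sym by blast
qed

end

section \<open>The number of Ulrich modules\<close>

lemma (in cyclic_action) ulrich_M_mod_iff:
  assumes cs: "\<forall>c\<in>set cs. c \<ge> 2" "cs \<noteq> []" "int n = hj_num cs" "int a = hj_den cs"
    and t: "0 \<le> t" "t < int n"
  shows "ulrich (invariant_ring z a) (M_mod n a z t) \<longleftrightarrow> t \<in> top_residues cs"
proof -
  have "0 \<le> (\<Sum>c\<leftarrow>cs. c - 2)" using cs(1) by (induction cs) auto
  moreover have "int (card (min_points (int n) (int a) t)) = greedy_sum cs t + 1"
    using card_min_points[OF cs(1)] t cs by simp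
  moreover have "ulrich (invariant_ring z a) (M_mod n a z t) \<longleftrightarrow>
      card (min_points (int n) (int a) t) = nat (\<Sum>c\<leftarrow>cs. c - 2) + 2"
    unfolding ulrich_def num_gens_M_mod multiplicity_of_M_mod[OF cs] of_nat_eq_iff using mcm_M_mod by blast
  ultimately show ?thesis using t cs(3) by (auto simp: top_residues_def excess_def)
qed

lemma (in cyclic_action) inj_on_M_mod: "inj_on (M_mod n a z) {0..<int n}"
  and module_iso_refl: "module_iso (invariant_ring z a) M M"
proof -
  show refl: "module_iso (invariant_ring z a) M M" for M :: "'k series2 set"
    unfolding module_iso_def by (intro exI[of _ id]) simp
  show "inj_on (M_mod n a z) {0..<int n}"
  proof (rule inj_onI)
    fix s t assume "s \<in> {0..<int n}" "t \<in> {0..<int n}" "M_mod n a z s = M_mod n a z t"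
    then show "s = t" using module_iso_M_mod[of s t] refl by (simp add: cong_def)
  qed
qed

lemma card_quotient_Id_on: "card (A // Id_on A) = card A"
proof -
  have "A // Id_on A = (\<lambda>x. {x}) ` A" by (auto simp: quotient_def)
  then show ?thesis by (simp add: card_image)
qed

text \<open>The modules with \<open>0 \<le> t < n\<close> are pairwise non-isomorphic, so the isomorphism classes are singletons.\<close>

lemma (in cyclic_action) num_ulrich_eq_top_count:
  assumes cs: "\<forall>c\<in>set cs. c \<ge> 2" "cs \<noteq> []" "int n = hj_num cs" "int a = hj_den cs"
  shows "num_ulrich n a z = top_count cs"
proof -
  let ?U = "indec_ulrich n a z"
  have sub: "top_residues cs \<subseteq> {0..<int n}" using cs(3) by (auto simp: top_residues_def)
  have U: "?U = M_mod n a z ` top_residues cs"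
    unfolding indec_ulrich_def using ulrich_M_mod_iff[OF cs] indecomposable_M_mod sub by fastforce
  have "{(M, N). M \<in> ?U \<and> N \<in> ?U \<and> module_iso (invariant_ring z a) M N} = Id_on ?U"
  proof (intro equalityI subrelI)
    fix M N assume "(M, N) \<in> {(M, N). M \<in> ?U \<and> N \<in> ?U \<and> module_iso (invariant_ring z a) M N}"
    then obtain s t where st: "M = M_mod n a z s" "N = M_mod n a z t" "s \<in> {0..<int n}" "t \<in> {0..<int n}"
      and iso: "module_iso (invariant_ring z a) M N" and M: "M \<in> ?U" unfolding U using sub by blast
    have "s = t" using module_iso_M_mod[of s t] iso st by (simp add: cong_def)
    then show "(M, N) \<in> Id_on ?U" using M st Id_onI by metis
  qed (use module_iso_refl in auto)
  then have "num_ulrich n a z = card ?U" unfolding num_ulrich_def by (simp add: card_quotient_Id_on)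
  also have "\<dots> = card (top_residues cs)"
    unfolding U by (rule card_image[OF inj_on_subset[OF inj_on_M_mod sub]])
  finally show ?thesis using card_residues[OF cs(1)] by simp
qed

theorem theorem4p5:
  fixes n a r :: nat and \<zeta> :: "'k::alg_closed_field" and \<alpha> :: "int list"
  assumes "1 \<le> a" and "a \<le> n - 1" and "coprime a n"
    and "(of_nat n :: 'k) \<noteq> 0"
    and "primitive_root_of_unity n \<zeta>"
    and "hj_expansion n a \<alpha>" and "r = length \<alpha>"
  shows "r \<le> num_ulrich n a \<zeta> \<and> num_ulrich n a \<zeta> \<le> 2 ^ (r - 1) \<and>
    (r = 1 \<or> r = 2 \<longrightarrow> num_ulrich n a \<zeta> = r) \<and>
    (r > 2 \<longrightarrow>
      (num_ulrich n a \<zeta> = 2 ^ (r - 1) \<longleftrightarrow> (\<forall>u\<in>{2..r - 1}. \<alpha> ! (u - 1) > 2)) \<and>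
      (num_ulrich n a \<zeta> = r \<longleftrightarrow> (\<forall>u\<in>{2..r - 1}. \<alpha> ! (u - 1) = 2)))"
proof -
  interpret cyclic_action n a \<zeta>
    using assms by unfold_locales auto
  have ge2: "\<forall>c\<in>set \<alpha>. c \<ge> 2" and ne: "\<alpha> \<noteq> []" using assms(6) by (auto simp: hj_expansion_def)
  have N: "num_ulrich n a \<zeta> = top_count \<alpha>"
    by (rule num_ulrich_eq_top_count[OF ge2 ne hj_expansion_num_den[OF assms(6,3,1)]])
  have lower: "r \<le> top_count \<alpha>" using top_count_ge_length[of \<alpha>] assms(7) by simp
  have upper: "top_count \<alpha> \<le> 2 ^ (r - 1)" using count_le_power[OF ne] assms(7) by simp
  obtain c cs where \<alpha>: "\<alpha> = c # cs" using ne by (cases \<alpha>) auto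
  have ge2_tl: "x \<ge> 2" if "x \<in> set (butlast cs)" for x
    using ge2 in_set_butlastD[OF that] by (simp add: \<alpha>)
  have "top_count \<alpha> = 2 ^ (r - 1) \<longleftrightarrow> (\<forall>x\<in>set (butlast (tl \<alpha>)). x > 2)"
  proof -
    have "x > 2 \<longleftrightarrow> x \<ge> 3" for x :: int by auto
    then show ?thesis using count_eq_power_iff[of c cs] assms(7) by (simp add: \<alpha>)
  qed
  moreover have "top_count \<alpha> = r \<longleftrightarrow> (\<forall>x\<in>set (butlast (tl \<alpha>)). x = 2)"
    using top_count_eq_length_iff[of c cs] assms(7) ge2_tl by (force simp: \<alpha>)
  moreover have "r = 1 \<or> r = 2 \<longrightarrow> top_count \<alpha> = r" using lower upper by auto
  ultimately show ?thesis
    using lower upper set_butlast_tl_iff[OF ne] unfolding N assms(7) by simp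
qed

end
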